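(* For every integer $n \geq 17$ there exist two non-empty families of trees $\mathcal{T}^1_n = \{T^1_1, T^1_2, \dots\}$ and $\mathcal{T}^2_n = \{T^2_1, T^2_2, \dots\}$, indexed by the same set of indices $i \ge 1$, all of whose members are trees on $n$ vertices, such that for every index $i$: (1) $T^1_i$ and $T^2_i$ are not isomorphic (as graphs), but they are co-spectral and their complements $\overline{T^1_i}$ and $\overline{T^2_i}$ are co-spectral; and (2) the right-angled Coxeter groups $G(T^1_i)$ and $G(T^2_i)$ have equal geodesic growth series (each with respect to its standard generating set).
   Context: All graphs are finite and simple. Two graphs are co-spectral if the characteristic polynomials of their adjacency matrices are equal. The complement $\overline{\Gamma}$ of a graph $\Gamma$ has the same vertices, with two distinct vertices adjacent exactly when they are not adjacent in $\Gamma$. For a graph $\Gamma$ with vertex set $V$ and edge set $E$, the right-angled Coxeter group (RACG) based on $\Gamma$ is $$G(\Gamma) = \langle s \in V \mid s^2 = 1 \ \forall s \in V,\ ss' = s's \ \forall \{s,s'\} \in E \rangle,$$ and its standard generating set is $S = V$. For a group $G$ generated by a finite set $S$, let $S^*$ be the set of words over $S$, $|w|$ the length of a word $w$, $\overline{w}$ its image in $G$, and $|g|_S$ the word length of $g \in G$, i.e. the least length of a word over $S$ representing $g$ (for a RACG each generator is its own inverse). A word $w \in S^*$ is geodesic if $|w| = |\overline{w}|_S$. The geodesic growth series of $G$ with respect to $S$ is the formal power series $\sum_{r \ge 0} f(r)\,t^r$, where $f(r)$ is the number of geodesic words of length $r$ in $S^*$. *)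

theory Defs
  imports
    "Graph_Theory.Graph_Theory"
    "Jordan_Normal_Form.Char_Poly"
    "HOL-Algebra.Group"
    "HOL-Computational_Algebra.Formal_Power_Series"
begin

section \<open>Finite simple graphs\<close>

text \<open>
  A finite simple graph is a \<^locale>\<open>pair_graph\<close>: a finite, loop-free, symmetric digraph without
  parallel arcs. The edge \<open>{u, v}\<close> is represented by the two arcs \<open>(u, v)\<close> and \<open>(v, u)\<close>.

  The library predicates \<^const>\<open>forest\<close> and \<^const>\<open>tree\<close> are of no use for this representation:
  they count the closed walk \<open>u, v, u\<close> along a single edge as a cycle. The cycles of an
  undirected graph are the cycles of length at least 3 of the symmetric digraph.
\<close>

definition tree_graph :: "'a pair_pre_digraph \<Rightarrow> bool" where
  "tree_graph \<Gamma> \<longleftrightarrow>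
     pair_graph \<Gamma> \<and> Digraph_Component.connected (with_proj \<Gamma>) \<and>
     \<not> (\<exists>p. pre_digraph.cycle (with_proj \<Gamma>) p \<and> length p \<ge> 3)"

definition graph_complement :: "'a pair_pre_digraph \<Rightarrow> 'a pair_pre_digraph" where
  "graph_complement \<Gamma> =
     \<lparr> pverts = pverts \<Gamma>,
       parcs = {(u, v). u \<in> pverts \<Gamma> \<and> v \<in> pverts \<Gamma> \<and> u \<noteq> v \<and> (u, v) \<notin> parcs \<Gamma>} \<rparr>"

text \<open>
  Rows and columns are indexed by the vertices in increasing order; the characteristic polynomial
  does not depend on the chosen enumeration of the vertices.
\<close>

definition adjacency_matrix :: "'a :: linorder pair_pre_digraph \<Rightarrow> int mat" where
  "adjacency_matrix \<Gamma> =
     (let vs = sorted_list_of_set (pverts \<Gamma>) in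
      mat (length vs) (length vs) (\<lambda>(i, j). if (vs ! i, vs ! j) \<in> parcs \<Gamma> then 1 else 0))"

definition cospectral :: "'a :: linorder pair_pre_digraph \<Rightarrow> 'b :: linorder pair_pre_digraph \<Rightarrow> bool"
  where
  "cospectral \<Gamma> \<Delta> \<longleftrightarrow> char_poly (adjacency_matrix \<Gamma>) = char_poly (adjacency_matrix \<Delta>)"

lemma pair_graph_graph_complement:
  assumes "pair_graph \<Gamma>"
  shows "pair_graph (graph_complement \<Gamma>)"
proof -
  interpret pair_graph \<Gamma> by fact
  have sym: "(u, v) \<in> parcs \<Gamma> \<longleftrightarrow> (v, u) \<in> parcs \<Gamma>" for u v
    by (metis arcs_symmetric)
  have fin: "finite (parcs (graph_complement \<Gamma>))"
    by (rule finite_subset[of _ "pverts \<Gamma> \<times> pverts \<Gamma>"]) (auto simp: graph_complement_def)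
  have "symmetric (with_proj (graph_complement \<Gamma>))"
    by (auto simp: symmetric_def graph_complement_def sym intro!: symI)
  then show ?thesis
    using fin pair_finite_verts by unfold_locales (auto simp: graph_complement_def)
qed


section \<open>Groups given by generators and relations\<close>

text \<open>
  A letter \<open>(True, x)\<close> stands for the generator \<open>x\<close> and \<open>(False, x)\<close> for its formal inverse. A
  relation \<open>(l, r)\<close> reads \<open>l = r\<close>. The presented group is the quotient of the words over the
  letters by the least congruence that contains the relations and cancels inverse pairs.
\<close>

type_synonym 'a letter = "bool \<times> 'a"

abbreviation letter_words :: "'a set \<Rightarrow> 'a letter list set" where
  "letter_words X \<equiv> lists (UNIV \<times> X)"

inductive_set presentation_cong ::
    "'a set \<Rightarrow> ('a letter list \<times> 'a letter list) set \<Rightarrow> ('a letter list \<times> 'a letter list) set"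
  for X :: "'a set" and R :: "('a letter list \<times> 'a letter list) set"
where
  refl: "w \<in> letter_words X \<Longrightarrow> (w, w) \<in> presentation_cong X R"
| sym: "(u, v) \<in> presentation_cong X R \<Longrightarrow> (v, u) \<in> presentation_cong X R"
| trans: "(u, v) \<in> presentation_cong X R \<Longrightarrow> (v, w) \<in> presentation_cong X R \<Longrightarrow>
    (u, w) \<in> presentation_cong X R"
| append: "(u, u') \<in> presentation_cong X R \<Longrightarrow> (v, v') \<in> presentation_cong X R \<Longrightarrow>
    (u @ v, u' @ v') \<in> presentation_cong X R"
| cancel: "x \<in> X \<Longrightarrow> ([(b, x), (\<not> b, x)], []) \<in> presentation_cong X R"
| relation: "(l, r) \<in> R \<Longrightarrow> l \<in> letter_words X \<Longrightarrow> r \<in> letter_words X \<Longrightarrow>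
    (l, r) \<in> presentation_cong X R"

definition presented_group ::
    "'a set \<Rightarrow> ('a letter list \<times> 'a letter list) set \<Rightarrow> 'a letter list set monoid" where
  "presented_group X R =
     \<lparr> carrier = letter_words X // presentation_cong X R,
       mult = (\<lambda>A B. \<Union>u\<in>A. \<Union>v\<in>B. presentation_cong X R `` {u @ v}),
       one = presentation_cong X R `` {[]} \<rparr>"

definition presented_generator ::
    "'a set \<Rightarrow> ('a letter list \<times> 'a letter list) set \<Rightarrow> 'a \<Rightarrow> 'a letter list set" where
  "presented_generator X R x = presentation_cong X R `` {[(True, x)]}"

lemma presentation_cong_words:
  "(u, v) \<in> presentation_cong X R \<Longrightarrow> u \<in> letter_words X \<and> v \<in> letter_words X"
  by (induction rule: presentation_cong.induct) auto

lemma equiv_presentation_cong: "equiv (letter_words X) (presentation_cong X R)"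
proof (rule equivI)
  show "presentation_cong X R \<subseteq> letter_words X \<times> letter_words X"
    using presentation_cong_words by fastforce
  show "refl_on (letter_words X) (presentation_cong X R)"
    by (rule refl_onI) (auto intro: presentation_cong.refl)
  show "Relation.sym (presentation_cong X R)"
    by (rule symI) (rule presentation_cong.sym)
  show "Relation.trans (presentation_cong X R)"
    by (rule transI) (rule presentation_cong.trans)
qed

lemma presented_group_mult_class:
  assumes "u \<in> letter_words X" "v \<in> letter_words X"
  shows "presentation_cong X R `` {u} \<otimes>\<^bsub>presented_group X R\<^esub> presentation_cong X R `` {v} =
         presentation_cong X R `` {u @ v}"
proof -
  let ?E = "presentation_cong X R"
  have eq: "?E `` {u' @ v'} = ?E `` {u @ v}" if "u' \<in> ?E `` {u}" "v' \<in> ?E `` {v}" for u' v'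
    using equiv_class_eq[OF equiv_presentation_cong presentation_cong.append] that by blast
  have "u \<in> ?E `` {u}" "v \<in> ?E `` {v}"
    using assms by (auto intro: presentation_cong.refl)
  then have "(\<Union>u'\<in>?E `` {u}. \<Union>v'\<in>?E `` {v}. ?E `` {u' @ v'}) = ?E `` {u @ v}"
    using eq by blast
  then show ?thesis
    by (simp add: presented_group_def)
qed

lemma presentation_cong_inverse:
  assumes "w \<in> letter_words X"
  shows "(rev (map (apfst Not) w) @ w, []) \<in> presentation_cong X R"
  using assms
proof (induction w rule: list.induct)
  case Nil
  then show ?case by (auto intro: presentation_cong.refl)
next
  case (Cons a w)
  obtain b x where a: "a = (b, x)" by (cases a)
  let ?v = "rev (map (apfst Not) w)"
  have "a \<in> UNIV \<times> X \<and> w \<in> letter_words X"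
    using Cons.prems by (simp only: Cons_in_lists_iff)
  then have w: "w \<in> letter_words X" and x: "x \<in> X" by (simp_all only: a mem_Times_iff snd_conv)
  have v: "?v \<in> letter_words X" using w by (auto simp: in_lists_conv_set)
  have "([(\<not> b, x), (b, x)], []) \<in> presentation_cong X R"
    using presentation_cong.cancel[OF x, of "\<not> b" R] by simp
  from presentation_cong.append[OF presentation_cong.refl[OF v]
      presentation_cong.append[OF this presentation_cong.refl[OF w]]]
  have "(rev (map (apfst Not) (a # w)) @ a # w, ?v @ w) \<in> presentation_cong X R"
    by (simp add: a)
  then show ?case using Cons.IH[OF w] by (rule presentation_cong.trans)
qed

lemma group_presented_group: "group (presented_group X R)"
proof (rule groupI)
  let ?E = "presentation_cong X R" and ?G = "presented_group X R"
  have carrier: "carrier ?G = {?E `` {w} |w. w \<in> letter_words X}"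
    by (auto simp: presented_group_def quotient_def)
  have one: "\<one>\<^bsub>?G\<^esub> = ?E `` {[]}"
    by (simp add: presented_group_def)
  show "\<one>\<^bsub>?G\<^esub> \<in> carrier ?G"
    unfolding one carrier by (intro CollectI exI[of _ "[]"]) simp
  show "A \<otimes>\<^bsub>?G\<^esub> B \<in> carrier ?G" if "A \<in> carrier ?G" "B \<in> carrier ?G" for A B
  proof -
    obtain u v where u: "u \<in> letter_words X" "A = ?E `` {u}" and v: "v \<in> letter_words X" "B = ?E `` {v}"
      using \<open>A \<in> carrier ?G\<close> \<open>B \<in> carrier ?G\<close> unfolding carrier by blast
    then have "A \<otimes>\<^bsub>?G\<^esub> B = ?E `` {u @ v}" and "u @ v \<in> letter_words X"
      by (simp only: presented_group_mult_class) (simp only: append_in_lists_conv u v)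
    then show ?thesis unfolding carrier by blast
  qed
  show "A \<otimes>\<^bsub>?G\<^esub> B \<otimes>\<^bsub>?G\<^esub> C = A \<otimes>\<^bsub>?G\<^esub> (B \<otimes>\<^bsub>?G\<^esub> C)"
    if "A \<in> carrier ?G" "B \<in> carrier ?G" "C \<in> carrier ?G" for A B C
  proof -
    obtain u v w where "u \<in> letter_words X" "A = ?E `` {u}" "v \<in> letter_words X" "B = ?E `` {v}"
        "w \<in> letter_words X" "C = ?E `` {w}"
      using \<open>A \<in> carrier ?G\<close> \<open>B \<in> carrier ?G\<close> \<open>C \<in> carrier ?G\<close> unfolding carrier by blast
    then show ?thesis
      by (simp only: presented_group_mult_class append_in_lists_conv append_assoc simp_thms)
  qed
  show "\<one>\<^bsub>?G\<^esub> \<otimes>\<^bsub>?G\<^esub> A = A" if A: "A \<in> carrier ?G" for A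
  proof -
    obtain w where "w \<in> letter_words X" "A = ?E `` {w}"
      using A unfolding carrier by auto
    then show ?thesis
      by (simp only: one presented_group_mult_class lists.Nil append_Nil)
  qed
  show "\<exists>B\<in>carrier ?G. B \<otimes>\<^bsub>?G\<^esub> A = \<one>\<^bsub>?G\<^esub>" if A: "A \<in> carrier ?G" for A
  proof -
    obtain w where w: "w \<in> letter_words X" "A = ?E `` {w}"
      using A unfolding carrier by auto
    let ?v = "rev (map (apfst Not) w)"
    have v: "?v \<in> letter_words X" using w(1) by (auto simp: in_lists_conv_set)
    have "?E `` {?v} \<otimes>\<^bsub>?G\<^esub> A = \<one>\<^bsub>?G\<^esub>"
      using equiv_class_eq[OF equiv_presentation_cong presentation_cong_inverse[OF w(1)]]
      by (simp add: w(2) one presented_group_mult_class[OF v w(1)])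
    then show ?thesis using v unfolding carrier by blast
  qed
qed


section \<open>Right-angled Coxeter groups\<close>

definition racg_relations :: "'a pair_pre_digraph \<Rightarrow> ('a letter list \<times> 'a letter list) set" where
  "racg_relations \<Gamma> =
     {([(True, s), (True, s)], []) |s. s \<in> pverts \<Gamma>} \<union>
     {([(True, s), (True, s')], [(True, s'), (True, s)]) |s s'. (s, s') \<in> parcs \<Gamma>}"

definition racg :: "'a pair_pre_digraph \<Rightarrow> 'a letter list set monoid" where
  "racg \<Gamma> = presented_group (pverts \<Gamma>) (racg_relations \<Gamma>)"

definition racg_generator :: "'a pair_pre_digraph \<Rightarrow> 'a \<Rightarrow> 'a letter list set" where
  "racg_generator \<Gamma> = presented_generator (pverts \<Gamma>) (racg_relations \<Gamma>)"


section \<open>Geodesic growth\<close>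

text \<open>
  In the following, \<open>S\<close> is the set of generators, viewed as an alphabet, and \<open>\<gamma>\<close> sends each
  letter to the group element it denotes. Words are positive words over \<open>S\<close>.
\<close>

definition word_image :: "('g, 'm) monoid_scheme \<Rightarrow> ('s \<Rightarrow> 'g) \<Rightarrow> 's list \<Rightarrow> 'g" where
  "word_image G \<gamma> w = foldr (\<lambda>s g. \<gamma> s \<otimes>\<^bsub>G\<^esub> g) w \<one>\<^bsub>G\<^esub>"

definition word_length :: "('g, 'm) monoid_scheme \<Rightarrow> 's set \<Rightarrow> ('s \<Rightarrow> 'g) \<Rightarrow> 'g \<Rightarrow> nat" where
  "word_length G S \<gamma> g = (LEAST k. \<exists>w\<in>lists S. length w = k \<and> word_image G \<gamma> w = g)"

definition geodesic_word :: "('g, 'm) monoid_scheme \<Rightarrow> 's set \<Rightarrow> ('s \<Rightarrow> 'g) \<Rightarrow> 's list \<Rightarrow> bool" where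
  "geodesic_word G S \<gamma> w \<longleftrightarrow> w \<in> lists S \<and> length w = word_length G S \<gamma> (word_image G \<gamma> w)"

definition geodesic_growth_series ::
    "('g, 'm) monoid_scheme \<Rightarrow> 's set \<Rightarrow> ('s \<Rightarrow> 'g) \<Rightarrow> int fps" where
  "geodesic_growth_series G S \<gamma> =
     Abs_fps (\<lambda>r. int (card {w. geodesic_word G S \<gamma> w \<and> length w = r}))"

definition racg_geodesic_growth_series :: "'a pair_pre_digraph \<Rightarrow> int fps" where
  "racg_geodesic_growth_series \<Gamma> =
     geodesic_growth_series (racg \<Gamma>) (pverts \<Gamma>) (racg_generator \<Gamma>)"

end

theory Submission
  imports Defs
begin

text \<open>
  Both trees arise from one tree on 16 vertices by attaching \<open>n - 16\<close> leaves, at the vertex 0 or at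
  the vertex 3.

  Spectra: the reflection \<open>Q\<close> along the subspace spanned by the vectors \<open>A\<^sup>k (e\<^sub>0 - e\<^sub>3)\<close>, where \<open>A\<close> is
  the adjacency matrix of the 16-vertex tree, commutes with \<open>A\<close>, swaps \<open>e\<^sub>0\<close> and \<open>e\<^sub>3\<close> and fixes the
  all-ones vector. Extended by the identity on the leaves it conjugates the adjacency matrices of the
  two trees, and also those of their complements.

  Geodesic growth: a word is geodesic unless it contains \<open>s y s\<close> with all letters of \<open>y\<close> commuting
  with \<open>s\<close>. For a triangle-free graph with adjacency matrix \<open>A\<close> and degree matrix \<open>D\<close>, the growth
  series is determined by the number of vertices and the sum of the entries of the solution of
  \<open>((1 + X) (1 + 2 X) - X (1 + X) D + X\<^sup>2 A) z = - X D 1\<close>. A vector that this pencil of the 16-vertex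
  tree maps to a multiple of \<open>e\<^sub>0 - e\<^sub>3\<close>, whose entries sum to 0 and whose entries at 0 and 3 are
  opposite, transports the solution for one tree to the solution for the other.
\<close>

section \<open>Words up to commutation\<close>

locale commutation_graph =
  fixes E :: "'a \<Rightarrow> 'a \<Rightarrow> bool"
  assumes sym: "E a b \<Longrightarrow> E b a" and irrefl: "\<not> E a a"
begin

text \<open>Two words are related by commutations exactly if all their projections to pairs of
  non-commuting letters agree; taking this as the definition reduces the verification of the
  Coxeter relations below to computations with projections.\<close>

definition projection :: "'a \<Rightarrow> 'a \<Rightarrow> 'a list \<Rightarrow> 'a list" where
  "projection a b w = filter (\<lambda>x. x = a \<or> x = b) w"

definition trace_equiv :: "'a list \<Rightarrow> 'a list \<Rightarrow> bool" where
  "trace_equiv u v \<longleftrightarrow> (\<forall>a b. \<not> E a b \<longrightarrow> projection a b u = projection a b v)"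

text \<open>Commutations can bring such an \<open>s\<close> to the end of \<open>w\<close>. For a
  reduced \<open>w\<close> these letters form the right descent set of the group element.\<close>

definition cancels :: "'a \<Rightarrow> 'a list \<Rightarrow> bool" where
  "cancels s w \<longleftrightarrow> (\<exists>x y. w = x @ s # y \<and> (\<forall>t\<in>set y. E s t))"

definition reduced :: "'a list \<Rightarrow> bool" where
  "reduced w \<longleftrightarrow> \<not> (\<exists>x s y z. w = x @ s # y @ s # z \<and> (\<forall>t\<in>set y. E s t))"

text \<open>Right multiplication by the generator \<open>s\<close>, on reduced words up to \<open>trace_equiv\<close>.\<close>

definition mult_letter :: "'a \<Rightarrow> 'a list \<Rightarrow> 'a list" where
  "mult_letter s w = (if cancels s w then rev (remove1 s (rev w)) else w @ [s])"

lemma projection_append [simp]: "projection a b (u @ v) = projection a b u @ projection a b v"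
  by (simp add: projection_def)

text \<open>A letter commuting with \<open>s\<close> differs from \<open>s\<close> and from every
  letter that does not commute with \<open>s\<close>, so it is erased by a projection to a
  non-commuting pair containing \<open>s\<close>.\<close>

lemma projection_commuting:
  assumes "\<forall>t\<in>set y. E s t" "\<not> E a b" "s = a \<or> s = b"
  shows "projection a b y = []"
proof -
  have "t \<noteq> a \<and> t \<noteq> b" if "t \<in> set y" for t
  proof -
    have "E s t" "E t s" using assms(1) that sym[of s t] by auto
    then show ?thesis using assms(2,3) irrefl by metis
  qed
  then show ?thesis by (simp add: projection_def filter_empty_conv)
qed

lemma trace_equiv_refl [simp]: "trace_equiv w w"
  by (simp add: trace_equiv_def)

lemma trace_equiv_sym: "trace_equiv u v \<Longrightarrow> trace_equiv v u"
  by (simp add: trace_equiv_def)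

lemma trace_equiv_trans: "trace_equiv u v \<Longrightarrow> trace_equiv v w \<Longrightarrow> trace_equiv u w"
  by (simp add: trace_equiv_def)

text \<open>By \<open>irrefl\<close> the pairs \<open>a = b = s\<close> are among the non-commuting
  ones, and their projections record how often each letter occurs.\<close>

lemma trace_equiv_length:
  assumes "trace_equiv u v"
  shows "length u = length v"
proof -
  have "count_list u s = count_list v s" for s
  proof -
    have "projection s s u = projection s s v"
      using assms irrefl unfolding trace_equiv_def by blast
    moreover have "(\<lambda>x. x = s \<or> x = s) = (=) s" by auto
    ultimately have "filter ((=) s) u = filter ((=) s) v"
      unfolding projection_def by metis
    then show ?thesis by (simp add: count_list_eq_length_filter)
  qed
  then have "mset u = mset v"
    by (intro multiset_eqI) (simp add: count_mset)
  then show ?thesis by (rule mset_eq_length)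
qed

text \<open>The last \<open>s\<close> can move to the end exactly if no letter that fails to commute
  with it follows; the case \<open>t = s\<close> ensures that \<open>s\<close> occurs at all. In
  this form invariance under \<open>trace_equiv\<close> is immediate.\<close>

lemma cancels_iff:
  "cancels s w \<longleftrightarrow> (\<forall>t. \<not> E s t \<longrightarrow> projection s t w \<noteq> [] \<and> last (projection s t w) = s)"
proof
  assume "cancels s w"
  then obtain x y where w: "w = x @ s # y" and y: "\<forall>t\<in>set y. E s t"
    unfolding cancels_def by blast
  show "\<forall>t. \<not> E s t \<longrightarrow> projection s t w \<noteq> [] \<and> last (projection s t w) = s"
  proof (intro allI impI)
    fix t assume t: "\<not> E s t"
    have "projection s t w = projection s t x @ [s]"
      using projection_commuting[OF y t] unfolding w by (simp add: projection_def)
    then show "projection s t w \<noteq> [] \<and> last (projection s t w) = s" by simp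
  qed
next
  assume *: "\<forall>t. \<not> E s t \<longrightarrow> projection s t w \<noteq> [] \<and> last (projection s t w) = s"
  then have "projection s s w \<noteq> []" using irrefl by blast
  then have "s \<in> set w" by (auto simp: projection_def filter_empty_conv)
  then obtain x y where w: "w = x @ s # y" and s: "s \<notin> set y" by (metis split_list_last)
  have "E s t" if "t \<in> set y" for t
  proof (rule ccontr)
    assume t: "\<not> E s t"
    have ne: "projection s t y \<noteq> []" using that by (auto simp: projection_def filter_empty_conv)
    have "projection s t w = projection s t x @ s # projection s t y"
      unfolding w by (simp add: projection_def)
    then have "last (projection s t w) = last (projection s t y)" using ne by simp
    then have "s \<in> set (projection s t y)" using * t ne by (metis last_in_set)
    then show False using s by (simp add: projection_def)
  qed
  then show "cancels s w" using w unfolding cancels_def by blast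
qed

lemma cancels_trace_equiv: "trace_equiv u v \<Longrightarrow> cancels s u = cancels s v"
  by (simp add: cancels_iff trace_equiv_def)

lemma mult_letter_cancel:
  assumes "\<forall>t\<in>set y. E s t"
  shows "mult_letter s (x @ s # y) = x @ y"
proof -
  have "cancels s (x @ s # y)" using assms unfolding cancels_def by blast
  moreover have "s \<notin> set y" using assms irrefl by blast
  ultimately show ?thesis by (simp add: mult_letter_def remove1_append)
qed

text \<open>Seen through a projection, multiplication by \<open>s\<close> only drops or appends a
  final \<open>s\<close>. This reduces the Coxeter relations to identities between short list
  operations.\<close>

lemma projection_mult_letter:
  assumes "\<not> E a b"
  shows "projection a b (mult_letter s w) =
    (if s \<noteq> a \<and> s \<noteq> b then projection a b w
     else if cancels s w then butlast (projection a b w) else projection a b w @ [s])"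
proof (cases "cancels s w")
  case True
  then obtain x y where w: "w = x @ s # y" and y: "\<forall>t\<in>set y. E s t"
    unfolding cancels_def by blast
  have m: "mult_letter s w = x @ y" unfolding w by (rule mult_letter_cancel[OF y])
  show ?thesis
  proof (cases "s = a \<or> s = b")
    case True
    then have "projection a b w = projection a b x @ [s]" "projection a b (mult_letter s w) = projection a b x"
      using projection_commuting[OF y assms True] unfolding m by (auto simp: w projection_def)
    then show ?thesis using True \<open>cancels s w\<close> by auto
  next
    case False
    then show ?thesis unfolding m by (auto simp: w projection_def)
  qed
next
  case False
  then show ?thesis by (auto simp: mult_letter_def projection_def)
qed

lemma mult_letter_trace_equiv:
  "trace_equiv u v \<Longrightarrow> trace_equiv (mult_letter s u) (mult_letter s v)"
  using cancels_trace_equiv[of u v s]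
  by (auto simp: trace_equiv_def projection_mult_letter)

text \<open>If deleting \<open>s\<close> from \<open>x @ s # y\<close> created a forbidden pattern
  \<open>r q r\<close>, the pattern would straddle the gap. Then \<open>r\<close> occurs in
  \<open>y\<close> and commutes with \<open>s\<close>, so putting \<open>s\<close> back into
  \<open>q\<close> gives a forbidden pattern in \<open>w\<close>.\<close>

lemma reduced_mult_letter:
  assumes red: "reduced w"
  shows "reduced (mult_letter s w)"
proof (cases "cancels s w")
  case True
  then obtain x y where w: "w = x @ s # y" and y: "\<forall>t\<in>set y. E s t"
    unfolding cancels_def by blast
  have m: "mult_letter s w = x @ y" unfolding w by (rule mult_letter_cancel[OF y])
  show ?thesis unfolding m reduced_def
  proof
    assume "\<exists>p r q z. x @ y = p @ r # q @ r # z \<and> (\<forall>t\<in>set q. E r t)"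
    then obtain p r q z where eq: "x @ y = p @ r # q @ r # z" and q: "\<forall>t\<in>set q. E r t" by blast
    have no: False if "w = p' @ r # q' @ r # z'" "\<forall>t\<in>set q'. E r t" for p' q' z'
      using red that unfolding reduced_def by blast
    obtain us where us: "x = p @ us \<and> us @ y = r # q @ r # z \<or> x @ us = p \<and> y = us @ r # q @ r # z"
      using eq[THEN append_eq_append_conv2[THEN iffD1]] by blast
    show False
    proof (cases "x = p @ us \<and> us @ y = r # q @ r # z")
      case False
      then have "p = x @ us" "y = us @ r # q @ r # z" using us by auto
      then have "w = (x @ s # us) @ r # q @ r # z" using w by simp
      then show False using q by (rule no)
    next
      case True
      show False
      proof (cases us)
        case Nil
        then have "w = (x @ [s]) @ r # q @ r # z" using True Nil w by simp
        then show False using q by (rule no)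
      next
        case (Cons a us')
        then have x: "x = p @ r # us'" and eq': "us' @ y = q @ r # z" using True by auto
        obtain vs where vs: "us' = q @ vs \<and> vs @ y = r # z \<or> us' @ vs = q \<and> y = vs @ r # z"
          using eq'[THEN append_eq_append_conv2[THEN iffD1]] by blast
        show False
        proof (cases "us' = q @ vs \<and> vs @ y = r # z \<and> vs \<noteq> []")
          case True
          then obtain vs' where "vs = r # vs'" by (cases vs) auto
          then have "w = p @ r # q @ r # (vs' @ s # y)" using conjunct1[OF True] w x by simp
          then show False using q by (rule no)
        next
          case False
          then have split: "q = us' @ vs" "y = vs @ r # z" using vs by auto
          then have "E s r" using y by simp
          then have "E r s" by (rule sym)
          then have "\<forall>t\<in>set (us' @ s # vs). E r t" using q split by auto
          moreover have "w = p @ r # (us' @ s # vs) @ r # z" using w x split by simp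
          ultimately show False by (rule no[rotated])
        qed
      qed
    qed
  qed
next
  case False
  have m: "mult_letter s w = w @ [s]" using False by (simp add: mult_letter_def)
  show ?thesis unfolding m reduced_def
  proof
    assume "\<exists>p r q z. w @ [s] = p @ r # q @ r # z \<and> (\<forall>t\<in>set q. E r t)"
    then obtain p r q z where eq: "w @ [s] = p @ r # q @ r # z" and q: "\<forall>t\<in>set q. E r t" by blast
    show False
    proof (cases z rule: rev_cases)
      case Nil
      then have "w @ [s] = (p @ r # q) @ [r]" using eq by simp
      then have "w = p @ r # q" "s = r" by simp_all
      then show False using False q unfolding cancels_def by blast
    next
      case (snoc z' a)
      then have "w @ [s] = (p @ r # q @ r # z') @ [a]" using eq by simp
      then have "w = p @ r # q @ r # z'" by simp
      then show False using red q unfolding reduced_def by blast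
    qed
  qed
qed

text \<open>Deleting \<open>s\<close> and appending it again moves it past \<open>y\<close>, which
  changes the word but not its projections. Reducedness ensures that no earlier \<open>s\<close>
  becomes cancellable after the deletion.\<close>

lemma mult_letter_involution:
  assumes red: "reduced w"
  shows "trace_equiv (mult_letter s (mult_letter s w)) w"
proof (cases "cancels s w")
  case False
  then have "mult_letter s w = w @ s # []" by (simp add: mult_letter_def)
  then show ?thesis using mult_letter_cancel[of "[]" s w] by simp
next
  case True
  then obtain x y where w: "w = x @ s # y" and y: "\<forall>t\<in>set y. E s t"
    unfolding cancels_def by blast
  have m: "mult_letter s w = x @ y" unfolding w by (rule mult_letter_cancel[OF y])
  have "\<not> cancels s (x @ y)"
  proof
    assume "cancels s (x @ y)"
    then obtain p q where eq: "x @ y = p @ s # q" and q: "\<forall>t\<in>set q. E s t"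
      unfolding cancels_def by blast
    have "s \<notin> set y" using y irrefl by blast
    with eq obtain us where "x = p @ s # us" "q = us @ y"
      unfolding append_eq_append_conv2 append_eq_Cons_conv by auto
    then have "w = p @ s # us @ s # y" "\<forall>t\<in>set us. E s t" using w q by auto
    then show False using red unfolding reduced_def by blast
  qed
  then have mm: "mult_letter s (mult_letter s w) = x @ y @ [s]" unfolding m by (simp add: mult_letter_def)
  show ?thesis unfolding trace_equiv_def
  proof (intro allI impI)
    fix a b assume ab: "\<not> E a b"
    have "projection a b (x @ y @ [s]) = projection a b (x @ s # y)"
      using projection_commuting[OF y ab] by (cases "s = a \<or> s = b") (auto simp: projection_def)
    then show "projection a b (mult_letter s (mult_letter s w)) = projection a b w"
      using mm w by simp
  qed
qed

lemma cancels_mult_letter_commuting: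
  assumes "E a b"
  shows "cancels a (mult_letter b w) = cancels a w"
proof -
  have "projection a t (mult_letter b w) = projection a t w" if "\<not> E a t" for t
  proof -
    have "b \<noteq> a \<and> b \<noteq> t" using that assms irrefl by blast
    then show ?thesis using projection_mult_letter[OF that] by simp
  qed
  then show ?thesis by (simp add: cancels_iff)
qed

text \<open>A non-commuting pair cannot contain both \<open>a\<close> and \<open>b\<close>, so one
  of the two multiplications fixes the projection, and neither affects whether the other
  cancels.\<close>

lemma mult_letter_commute:
  assumes ab: "E a b"
  shows "trace_equiv (mult_letter a (mult_letter b w)) (mult_letter b (mult_letter a w))"
  unfolding trace_equiv_def
proof (intro allI impI)
  fix c d assume cd: "\<not> E c d"
  note ba = sym[OF ab]
  define f where "f s k q = (if s \<noteq> c \<and> s \<noteq> d then q else if k then butlast q else q @ [s])"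
    for s :: 'a and k :: bool and q :: "'a list"
  have f: "projection c d (mult_letter s v) = f s (cancels s v) (projection c d v)" for s v
    using projection_mult_letter[OF cd] by (simp add: f_def)
  have "(b \<noteq> c \<and> b \<noteq> d) \<or> (a \<noteq> c \<and> a \<noteq> d)" using cd ab ba irrefl by blast
  then have "(\<forall>k q. f b k q = q) \<or> (\<forall>k q. f a k q = q)" by (auto simp: f_def)
  then show "projection c d (mult_letter a (mult_letter b w)) =
      projection c d (mult_letter b (mult_letter a w))"
    by (auto simp: f cancels_mult_letter_commuting[OF ab] cancels_mult_letter_commuting[OF ba])
qed

text \<open>Together with \<open>cancels_snoc\<close> this describes an automaton for reduced words:
  the states are the sets of cancelling letters.\<close>

lemma reduced_snoc: "reduced (w @ [s]) \<longleftrightarrow> reduced w \<and> \<not> cancels s w"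
proof
  assume r: "reduced (w @ [s])"
  have "reduced w"
    unfolding reduced_def
  proof
    assume "\<exists>x r y z. w = x @ r # y @ r # z \<and> (\<forall>t\<in>set y. E r t)"
    then obtain x r' y z where "w = x @ r' # y @ r' # z" "\<forall>t\<in>set y. E r' t" by blast
    then have "w @ [s] = x @ r' # y @ r' # (z @ [s])" "\<forall>t\<in>set y. E r' t" by auto
    then show False using r unfolding reduced_def by blast
  qed
  moreover have "\<not> cancels s w"
  proof
    assume "cancels s w"
    then obtain x y where "w = x @ s # y" "\<forall>t\<in>set y. E s t" unfolding cancels_def by blast
    then have "w @ [s] = x @ s # y @ s # []" "\<forall>t\<in>set y. E s t" by auto
    then show False using r unfolding reduced_def by blast
  qed
  ultimately show "reduced w \<and> \<not> cancels s w" ..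
next
  assume "reduced w \<and> \<not> cancels s w"
  then show "reduced (w @ [s])" using reduced_mult_letter[of w s] by (simp add: mult_letter_def)
qed

lemma cancels_Nil [simp]: "\<not> cancels s []"
  by (simp add: cancels_def)

lemma cancels_snoc: "cancels t (w @ [s]) \<longleftrightarrow> t = s \<or> E t s \<and> cancels t w"
proof
  assume "cancels t (w @ [s])"
  then obtain x y where "w @ [s] = x @ t # y" "\<forall>r\<in>set y. E t r" unfolding cancels_def by blast
  then show "t = s \<or> E t s \<and> cancels t w"
    unfolding cancels_def by (cases y rule: rev_cases) auto
next
  assume "t = s \<or> E t s \<and> cancels t w"
  then show "cancels t (w @ [s])"
  proof
    assume "t = s"
    then show ?thesis unfolding cancels_def by (intro exI[of _ w] exI[of _ "[]"]) simp
  next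
    assume *: "E t s \<and> cancels t w"
    then obtain x y where "w = x @ t # y" "\<forall>r\<in>set y. E t r" unfolding cancels_def by blast
    then show ?thesis
      using * unfolding cancels_def by (intro exI[of _ x] exI[of _ "y @ [s]"]) auto
  qed
qed

section \<open>The action of words on reduced words\<close>

definition mult_word :: "'a list \<Rightarrow> 'a list \<Rightarrow> 'a list" where
  "mult_word w u = fold mult_letter u w"

lemma mult_word_simps [simp]:
  "mult_word w [] = w"
  "mult_word w (u @ v) = mult_word (mult_word w u) v"
  "mult_word w (s # u) = mult_word (mult_letter s w) u"
  by (simp_all add: mult_word_def)

lemma reduced_mult_word: "reduced w \<Longrightarrow> reduced (mult_word w u)"
  by (induction u arbitrary: w) (simp_all add: reduced_mult_letter)

lemma mult_word_trace_equiv: "trace_equiv w w' \<Longrightarrow> trace_equiv (mult_word w u) (mult_word w' u)"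
  by (induction u arbitrary: w w') (simp_all add: mult_letter_trace_equiv)

lemma length_mult_word: "length (mult_word w u) \<le> length w + length u"
proof (induction u arbitrary: w)
  case (Cons s u)
  have "length (mult_letter s w) \<le> Suc (length w)"
    by (auto simp: mult_letter_def length_remove1)
  then show ?case using Cons[of "mult_letter s w"] by simp
qed simp

text \<open>Every letter of a reduced word is appended rather than cancelled. Hence the action on
  the empty word tells inequivalent reduced words apart.\<close>

lemma mult_word_reduced: "reduced w \<Longrightarrow> mult_word [] w = w"
  by (induction w rule: rev_induct) (simp_all add: reduced_snoc, simp add: mult_letter_def)

lemma reduced_Nil [simp]: "reduced []"
  by (simp add: reduced_def)

end

section \<open>Geodesics in right-angled Coxeter groups\<close>

lemma pair_graph_commutation:
  assumes "pair_graph \<Gamma>"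
  shows "commutation_graph (\<lambda>a b. (a, b) \<in> parcs \<Gamma>)"
proof -
  interpret pair_graph \<Gamma> by fact
  show ?thesis
  proof
    show "(b, a) \<in> parcs \<Gamma>" if "(a, b) \<in> parcs \<Gamma>" for a b
      using that arcs_symmetric by blast
    show "(a, a) \<notin> parcs \<Gamma>" for a
      using no_loops by fastforce
  qed
qed

abbreviation positive_word :: "'a list \<Rightarrow> 'a letter list" where
  "positive_word \<equiv> map (Pair True)"

lemma positive_word_in_letter_words: "w \<in> lists X \<Longrightarrow> positive_word w \<in> letter_words X"
  by (auto simp: in_lists_conv_set)

lemma word_image_presented_group:
  assumes "w \<in> lists X"
  shows "word_image (presented_group X R) (presented_generator X R) w =
    presentation_cong X R `` {positive_word w}"
  using assms
proof (induction w)
  case Nil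
  then show ?case by (simp add: word_image_def presented_group_def)
next
  case (Cons s w)
  have s: "[(True, s)] \<in> letter_words X" and w: "positive_word w \<in> letter_words X"
    using Cons.hyps positive_word_in_letter_words[of "[s]" X] positive_word_in_letter_words[of w X]
    by simp_all
  have "word_image (presented_group X R) (presented_generator X R) (s # w) =
      presented_generator X R s \<otimes>\<^bsub>presented_group X R\<^esub> presentation_cong X R `` {positive_word w}"
    using Cons.IH by (simp add: word_image_def)
  also have "\<dots> = presentation_cong X R `` {positive_word (s # w)}"
    using presented_group_mult_class[OF s w, of R] by (simp add: presented_generator_def)
  finally show ?case .
qed

locale racg_graph =
  fixes \<Gamma> :: "'a pair_pre_digraph"
  assumes pair_graph: "pair_graph \<Gamma>"
begin

sublocale commutation_graph "\<lambda>a b. (a, b) \<in> parcs \<Gamma>"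
  by (rule pair_graph_commutation[OF pair_graph])

abbreviation racg_cong :: "('a letter list \<times> 'a letter list) set" where
  "racg_cong \<equiv> presentation_cong (pverts \<Gamma>) (racg_relations \<Gamma>)"

lemma parcs_pverts: "(a, b) \<in> parcs \<Gamma> \<Longrightarrow> a \<in> pverts \<Gamma> \<and> b \<in> pverts \<Gamma>"
proof -
  interpret pair_graph \<Gamma> by (rule pair_graph)
  show "(a, b) \<in> parcs \<Gamma> \<Longrightarrow> a \<in> pverts \<Gamma> \<and> b \<in> pverts \<Gamma>"
    using wellformed by fastforce
qed

lemma finite_pverts: "finite (pverts \<Gamma>)"
proof -
  interpret pair_graph \<Gamma> by (rule pair_graph)
  show ?thesis by simp
qed

text \<open>The group acts on reduced words up to \<open>trace_equiv\<close>: generators act as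
  commuting or free involutions, so a letter and its formal inverse may act alike and
  \<open>map snd\<close> can forget the sign.\<close>

lemma racg_cong_mult_word:
  assumes "(u, v) \<in> racg_cong" "reduced w"
  shows "trace_equiv (mult_word w (map snd u)) (mult_word w (map snd v))"
  using assms
proof (induction arbitrary: w rule: presentation_cong.induct)
  case (append u u' v v')
  have "trace_equiv (mult_word (mult_word w (map snd u)) (map snd v))
      (mult_word (mult_word w (map snd u')) (map snd v))"
    by (intro mult_word_trace_equiv append.IH append.prems)
  moreover have "trace_equiv (mult_word (mult_word w (map snd u')) (map snd v))
      (mult_word (mult_word w (map snd u')) (map snd v'))"
    by (intro append.IH reduced_mult_word append.prems)
  ultimately show ?case using trace_equiv_trans by simp
next
  case (cancel x b)
  then show ?case by (simp add: mult_letter_involution)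
next
  case (relation l r)
  then show ?case
    by (auto simp: racg_relations_def mult_letter_involution
        intro!: mult_letter_commute elim: sym)
qed (auto intro: trace_equiv_sym trace_equiv_trans)

lemma racg_cong_move:
  assumes "\<forall>t\<in>set y. (s, t) \<in> parcs \<Gamma>" "s \<in> pverts \<Gamma>"
  shows "(positive_word (s # y), positive_word (y @ [s])) \<in> racg_cong"
  using assms
proof (induction y)
  case Nil
  have "positive_word [s] \<in> letter_words (pverts \<Gamma>)"
    using Nil by (intro positive_word_in_letter_words) simp
  from presentation_cong.refl[OF this] show ?case by simp
next
  case (Cons t y)
  have st: "(s, t) \<in> parcs \<Gamma>" using Cons.prems by simp
  then have t: "t \<in> pverts \<Gamma>" using parcs_pverts by blast
  have w: "positive_word [s, t] \<in> letter_words (pverts \<Gamma>)"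
    "positive_word [t, s] \<in> letter_words (pverts \<Gamma>)" "positive_word [t] \<in> letter_words (pverts \<Gamma>)"
    "positive_word y \<in> letter_words (pverts \<Gamma>)"
    using t Cons.prems parcs_pverts by (auto intro!: positive_word_in_letter_words)
  have "(positive_word [s, t], positive_word [t, s]) \<in> racg_cong"
    using st w by (intro presentation_cong.relation) (auto simp: racg_relations_def)
  from presentation_cong.append[OF this presentation_cong.refl[OF w(4)]]
  have "(positive_word (s # t # y), positive_word (t # s # y)) \<in> racg_cong" by simp
  moreover have "(positive_word (s # y), positive_word (y @ [s])) \<in> racg_cong"
    using Cons by simp
  from presentation_cong.append[OF presentation_cong.refl[OF w(3)] this]
  have "(positive_word (t # s # y), positive_word (t # y @ [s])) \<in> racg_cong" by simp
  ultimately show ?case using presentation_cong.trans by fastforce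
qed

lemma racg_cong_cancel:
  assumes "\<forall>t\<in>set y. (s, t) \<in> parcs \<Gamma>" "x @ s # y @ s # z \<in> lists (pverts \<Gamma>)"
  shows "(positive_word (x @ s # y @ s # z), positive_word (x @ y @ z)) \<in> racg_cong"
proof -
  have s: "s \<in> pverts \<Gamma>" and w: "positive_word x \<in> letter_words (pverts \<Gamma>)"
    "positive_word y \<in> letter_words (pverts \<Gamma>)" "positive_word z \<in> letter_words (pverts \<Gamma>)"
    "positive_word [s] \<in> letter_words (pverts \<Gamma>)"
    using assms(2) by (auto intro!: positive_word_in_letter_words)
  have "(positive_word [s, s], []) \<in> racg_cong"
    using s positive_word_in_letter_words[of "[s, s]" "pverts \<Gamma>"]
    by (intro presentation_cong.relation) (auto simp: racg_relations_def)
  from presentation_cong.append[OF presentation_cong.refl[OF w(2)] this]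
  have "(positive_word (y @ [s, s]), positive_word y) \<in> racg_cong" by simp
  moreover have "(positive_word (s # y @ [s]), positive_word (y @ [s, s])) \<in> racg_cong"
    using presentation_cong.append[OF racg_cong_move[OF assms(1) s] presentation_cong.refl[OF w(4)]]
    by simp
  ultimately have "(positive_word (s # y @ [s]), positive_word y) \<in> racg_cong"
    using presentation_cong.trans by blast
  from presentation_cong.append[OF presentation_cong.refl[OF w(1)]
      presentation_cong.append[OF this presentation_cong.refl[OF w(3)]]]
  show ?thesis by simp
qed

lemma racg_image_eq_iff:
  assumes "u \<in> lists (pverts \<Gamma>)" "v \<in> lists (pverts \<Gamma>)"
  shows "word_image (racg \<Gamma>) (racg_generator \<Gamma>) u = word_image (racg \<Gamma>) (racg_generator \<Gamma>) v
    \<longleftrightarrow> (positive_word u, positive_word v) \<in> racg_cong"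
  unfolding racg_def racg_generator_def word_image_presented_group[OF assms(1)]
    word_image_presented_group[OF assms(2)]
  using assms by (intro eq_equiv_class_iff[OF equiv_presentation_cong] positive_word_in_letter_words)

text \<open>Any word for the element of a reduced \<open>w\<close> acts on \<open>[]\<close> to give
  a word as long as \<open>w\<close>, and each of its letters adds at most one to the length.
  Conversely, a forbidden pattern can be shortened by two letters.\<close>

lemma geodesic_word_iff_reduced:
  "geodesic_word (racg \<Gamma>) (pverts \<Gamma>) (racg_generator \<Gamma>) w \<longleftrightarrow> w \<in> lists (pverts \<Gamma>) \<and> reduced w"
proof -
  let ?im = "word_image (racg \<Gamma>) (racg_generator \<Gamma>)"
  let ?len = "word_length (racg \<Gamma>) (pverts \<Gamma>) (racg_generator \<Gamma>)"
  have len_le: "?len (?im w) \<le> length w'" if "w' \<in> lists (pverts \<Gamma>)" "?im w' = ?im w" for w'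
    unfolding word_length_def using that by (intro Least_le) blast
  have "length w = ?len (?im w)" if w: "w \<in> lists (pverts \<Gamma>)" and red: "reduced w"
  proof -
    have "?len (?im w) = length w"
      unfolding word_length_def
    proof (rule Least_equality)
      fix k assume "\<exists>w'\<in>lists (pverts \<Gamma>). length w' = k \<and> ?im w' = ?im w"
      then obtain w' where w': "w' \<in> lists (pverts \<Gamma>)" "length w' = k" "?im w' = ?im w" by blast
      then have "(positive_word w', positive_word w) \<in> racg_cong"
        using racg_image_eq_iff w by blast
      from racg_cong_mult_word[OF this reduced_Nil]
      have "trace_equiv (mult_word [] w') w"
        using mult_word_reduced[OF red] by (simp add: comp_def)
      then have "length w = length (mult_word [] w')" using trace_equiv_length by simp
      then show "length w \<le> k" using length_mult_word[of "[]" w'] w' by simp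
    qed (use w in blast)
    then show ?thesis by simp
  qed
  moreover have "reduced w" if w: "w \<in> lists (pverts \<Gamma>)" and geo: "length w = ?len (?im w)"
  proof (rule ccontr)
    assume "\<not> reduced w"
    then obtain x s y z where eq: "w = x @ s # y @ s # z" and y: "\<forall>t\<in>set y. (s, t) \<in> parcs \<Gamma>"
      unfolding reduced_def by blast
    have xyz: "x @ y @ z \<in> lists (pverts \<Gamma>)" using w eq by simp
    have "?im w = ?im (x @ y @ z)"
      using racg_image_eq_iff[OF w xyz] racg_cong_cancel[OF y] w eq by blast
    then have "?len (?im w) \<le> length (x @ y @ z)" using len_le[OF xyz] by simp
    then show False using geo eq by simp
  qed
  ultimately show ?thesis unfolding geodesic_word_def by blast
qed

section \<open>Counting reduced words by their states\<close>

text \<open>The reduced extensions of a word depend only on the set \<open>\<sigma>\<close> of letters that it can end with.\<close>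

primrec extension_count :: "nat \<Rightarrow> 'a set \<Rightarrow> int" where
  "extension_count 0 \<sigma> = 1"
| "extension_count (Suc r) \<sigma> =
    (\<Sum>s\<in>pverts \<Gamma> - \<sigma>. extension_count r (insert s {t \<in> \<sigma>. (t, s) \<in> parcs \<Gamma>}))"

text \<open>Split off the first letter of the extension: \<open>reduced_snoc\<close> says which
  letters are allowed and \<open>cancels_snoc\<close> which state they lead to.\<close>

lemma card_reduced_extensions:
  assumes "reduced w"
  shows "int (card {u \<in> lists (pverts \<Gamma>). length u = r \<and> reduced (w @ u)}) =
    extension_count r {s. cancels s w}"
  using assms
proof (induction r arbitrary: w)
  case 0
  have "{u \<in> lists (pverts \<Gamma>). length u = 0 \<and> reduced (w @ u)} = {[]}" using 0 by auto
  then show ?case by simp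
next
  case (Suc r)
  let ?D = "pverts \<Gamma> - {s. cancels s w}"
  let ?U = "\<lambda>s. {u \<in> lists (pverts \<Gamma>). length u = r \<and> reduced ((w @ [s]) @ u)}"
  have prefix: "reduced (v @ u) \<Longrightarrow> reduced v" for u v
  proof (induction u rule: rev_induct)
    case (snoc a u)
    then show ?case using reduced_snoc[of "v @ u" a] by simp
  qed simp
  have "{u \<in> lists (pverts \<Gamma>). length u = Suc r \<and> reduced (w @ u)} =
      (\<lambda>(s, u). s # u) ` (SIGMA s:?D. ?U s)" (is "?L = ?R")
  proof
    show "?L \<subseteq> ?R"
    proof
      fix v assume v: "v \<in> ?L"
      then obtain s u where su: "v = s # u" by (cases v) auto
      have "reduced (w @ [s])" using v su by (intro prefix[of "w @ [s]" u]) simp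
      then show "v \<in> ?R" using v su by (force simp: reduced_snoc)
    qed
    show "?R \<subseteq> ?L" by auto
  qed
  then have "card ?L = card (SIGMA s:?D. ?U s)"
    by (simp add: card_image inj_on_def split_beta prod_eq_iff)
  also have "\<dots> = (\<Sum>s\<in>?D. card (?U s))"
  proof (rule card_SigmaI)
    show "finite ?D" using finite_pverts by simp
    have "finite {u. set u \<subseteq> pverts \<Gamma> \<and> length u = r}"
      by (rule finite_lists_length_eq[OF finite_pverts])
    then show "\<forall>s\<in>?D. finite (?U s)"
      by (auto elim!: rev_finite_subset)
  qed
  finally have "int (card ?L) = (\<Sum>s\<in>?D. int (card (?U s)))" by simp
  also have "\<dots> = (\<Sum>s\<in>?D. extension_count r {t. cancels t (w @ [s])})"
    using Suc.prems by (intro sum.cong Suc.IH) (auto simp: reduced_snoc)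
  also have "\<dots> = (\<Sum>s\<in>?D. extension_count r (insert s {t \<in> {s. cancels s w}. (t, s) \<in> parcs \<Gamma>}))"
    by (intro sum.cong refl arg_cong2[of _ _ _ _ extension_count]) (auto simp: cancels_snoc)
  finally show ?case by simp
qed

lemma racg_geodesic_growth_series_nth:
  "fps_nth (racg_geodesic_growth_series \<Gamma>) r = extension_count r {}"
  using card_reduced_extensions[OF reduced_Nil, of r]
  by (simp add: racg_geodesic_growth_series_def geodesic_growth_series_def geodesic_word_iff_reduced
      conj_ac)

end


section \<open>The linear system of a triangle-free graph\<close>

context racg_graph
begin

abbreviation neighbours :: "'a \<Rightarrow> 'a set" where
  "neighbours v \<equiv> {s \<in> pverts \<Gamma>. (v, s) \<in> parcs \<Gamma>}"

text \<open>In a triangle-free graph the states are the empty set, vertices and edges. The edge states enter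
  the recursion of the vertex states only through the following sums.\<close>

definition neighbour_excess :: "nat \<Rightarrow> 'a \<Rightarrow> int" where
  "neighbour_excess r v =
    (\<Sum>s\<in>neighbours v. extension_count r {v, s} - extension_count r {s})"

text \<open>A letter \<open>s\<close> leads from the state \<open>{v}\<close> to
  \<open>{v, s}\<close> if it is adjacent to \<open>v\<close> and to \<open>{s}\<close> otherwise,
  where the empty state always leads to \<open>{s}\<close>. The subtracted term accounts for the
  excluded letter \<open>s = v\<close>.\<close>

lemma extension_count_singleton:
  assumes v: "v \<in> pverts \<Gamma>"
  shows "extension_count (Suc r) {v} =
    extension_count (Suc r) {} - extension_count r {v} + neighbour_excess r v"
proof -
  let ?g = "\<lambda>s. extension_count r {s} +
    (if (v, s) \<in> parcs \<Gamma> then extension_count r {v, s} - extension_count r {s} else 0)"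
  have g: "extension_count r (insert s {t \<in> {v}. (t, s) \<in> parcs \<Gamma>}) = ?g s" for s
  proof -
    have "insert s {t \<in> {v}. (t, s) \<in> parcs \<Gamma>} = (if (v, s) \<in> parcs \<Gamma> then {v, s} else {s})"
      by auto
    then show ?thesis by (simp only: split: if_split) simp
  qed
  have "extension_count (Suc r) {v} = (\<Sum>s\<in>pverts \<Gamma> - {v}. ?g s)"
    by (simp only: extension_count.simps g)
  also have "\<dots> = (\<Sum>s\<in>pverts \<Gamma>. ?g s) - ?g v"
    using v finite_pverts by (simp add: sum_diff1)
  also have "?g v = extension_count r {v}" using irrefl by simp
  also have "(\<Sum>s\<in>pverts \<Gamma>. ?g s) = extension_count (Suc r) {} + neighbour_excess r v"
    using finite_pverts
    by (simp add: sum.distrib neighbour_excess_def sum.inter_filter)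
  finally show ?thesis by simp
qed

text \<open>Without common neighbours of \<open>u\<close> and \<open>v\<close>, no state of three
  letters arises. The excluded letters \<open>u\<close> and \<open>v\<close> would each contribute
  \<open>extension_count r {u, v}\<close>.\<close>

lemma extension_count_edge:
  assumes tri: "\<And>s. (u, s) \<in> parcs \<Gamma> \<Longrightarrow> (v, s) \<in> parcs \<Gamma> \<Longrightarrow> False"
    and uv: "(u, v) \<in> parcs \<Gamma>"
  shows "extension_count (Suc r) {u, v} = extension_count (Suc r) {}
    + neighbour_excess r u + neighbour_excess r v - 2 * extension_count r {u, v}"
proof -
  let ?h = "\<lambda>w s. if (w, s) \<in> parcs \<Gamma> then extension_count r {w, s} - extension_count r {s} else 0"
  let ?g = "\<lambda>s. extension_count r {s} + ?h u s + ?h v s"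
  have V: "u \<in> pverts \<Gamma>" "v \<in> pverts \<Gamma>" and ne: "u \<noteq> v" and vu: "(v, u) \<in> parcs \<Gamma>"
    using uv parcs_pverts irrefl sym by auto
  have g: "extension_count r (insert s {t \<in> {u, v}. (t, s) \<in> parcs \<Gamma>}) = ?g s" for s
  proof -
    have "insert s {t \<in> {u, v}. (t, s) \<in> parcs \<Gamma>} =
        (if (u, s) \<in> parcs \<Gamma> then {u, s} else if (v, s) \<in> parcs \<Gamma> then {v, s} else {s})"
      using tri by auto
    then show ?thesis using tri[of s] by auto
  qed
  have "extension_count (Suc r) {u, v} = (\<Sum>s\<in>pverts \<Gamma> - {u, v}. ?g s)"
    by (simp only: extension_count.simps g)
  also have "\<dots> = (\<Sum>s\<in>pverts \<Gamma>. ?g s) - (\<Sum>s\<in>{u, v}. ?g s)"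
    using V finite_pverts by (intro sum_diff) auto
  also have "(\<Sum>s\<in>{u, v}. ?g s) = 2 * extension_count r {u, v}"
    using ne uv vu irrefl by (simp add: insert_commute)
  also have "(\<Sum>s\<in>pverts \<Gamma>. ?g s) =
      extension_count (Suc r) {} + neighbour_excess r u + neighbour_excess r v"
    using finite_pverts
    by (simp add: sum.distrib neighbour_excess_def sum.inter_filter)
  finally show ?thesis .
qed

text \<open>In the difference of the edge and vertex recursions the terms
  \<open>neighbour_excess r s\<close> cancel, so the edge states disappear from the system.\<close>

lemma neighbour_excess_Suc:
  assumes tri: "\<not> (\<exists>a b c. (a, b) \<in> parcs \<Gamma> \<and> (a, c) \<in> parcs \<Gamma> \<and> (b, c) \<in> parcs \<Gamma>)"
  shows "neighbour_excess (Suc r) v = (int (card (neighbours v)) - 2) * neighbour_excess r v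
    - (\<Sum>s\<in>neighbours v. extension_count r {s})"
proof -
  have "neighbour_excess (Suc r) v = (\<Sum>s\<in>neighbours v. neighbour_excess r v
      - 2 * (extension_count r {v, s} - extension_count r {s}) - extension_count r {s})"
    unfolding neighbour_excess_def[of "Suc r"]
  proof (rule sum.cong)
    fix s assume s: "s \<in> neighbours v"
    have "extension_count (Suc r) {v, s} = extension_count (Suc r) {}
        + neighbour_excess r v + neighbour_excess r s - 2 * extension_count r {v, s}"
      using s tri by (intro extension_count_edge) blast+
    moreover have "extension_count (Suc r) {s} =
        extension_count (Suc r) {} - extension_count r {s} + neighbour_excess r s"
      using s by (intro extension_count_singleton) simp
    ultimately show "extension_count (Suc r) {v, s} - extension_count (Suc r) {s} =
        neighbour_excess r v - 2 * (extension_count r {v, s} - extension_count r {s})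
        - extension_count r {s}"
      by simp
  qed simp
  also have "\<dots> = (\<Sum>s\<in>neighbours v. neighbour_excess r v) - 2 * neighbour_excess r v
      - (\<Sum>s\<in>neighbours v. extension_count r {s})"
    by (simp only: sum_subtractf sum_distrib_left[symmetric] neighbour_excess_def[of r v])
  finally show ?thesis by (simp add: left_diff_distrib)
qed

text \<open>Here \<open>y v\<close> is the generating function of \<open>neighbour_excess\<close>.
  The series \<open>a v\<close> of the vertex states are eliminated through
  \<open>(1 + X) a v = F + X y v\<close>.\<close>

lemma geodesic_growth_linear_system:
  assumes tri: "\<not> (\<exists>a b c. (a, b) \<in> parcs \<Gamma> \<and> (a, c) \<in> parcs \<Gamma> \<and> (b, c) \<in> parcs \<Gamma>)"
  defines "F \<equiv> racg_geodesic_growth_series \<Gamma>"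
  obtains y :: "'a \<Rightarrow> int fps" where
    "\<And>v. v \<in> pverts \<Gamma> \<Longrightarrow>
      (1 + fps_X) * (1 + 2 * fps_X) * y v - fps_X * (1 + fps_X) * of_nat (card (neighbours v)) * y v
        + fps_X ^ 2 * (\<Sum>s\<in>neighbours v. y s) = - fps_X * F * of_nat (card (neighbours v))"
    "(1 + fps_X) * (F - 1) = fps_X * (of_nat (card (pverts \<Gamma>)) * F + fps_X * (\<Sum>v\<in>pverts \<Gamma>. y v))"
proof -
  define a where "a v = Abs_fps (\<lambda>r. extension_count r {v})" for v
  define y where "y v = Abs_fps (\<lambda>r. neighbour_excess r v)" for v
  have F_eq: "F = 1 + fps_X * (\<Sum>v\<in>pverts \<Gamma>. a v)"
  proof (rule fps_ext)
    show "fps_nth F r = fps_nth (1 + fps_X * (\<Sum>v\<in>pverts \<Gamma>. a v)) r" for r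
      by (cases r) (simp_all add: F_def racg_geodesic_growth_series_nth fps_sum_nth a_def)
  qed
  have a_eq: "(1 + fps_X) * a v = F + fps_X * y v" if "v \<in> pverts \<Gamma>" for v
  proof (rule fps_ext)
    show "fps_nth ((1 + fps_X) * a v) r = fps_nth (F + fps_X * y v) r" for r
      using extension_count_singleton[OF that, of "r - 1"]
      by (cases r) (simp_all add: F_def racg_geodesic_growth_series_nth a_def y_def
          distrib_right del: extension_count.simps(2))
  qed
  have y_eq: "(1 + 2 * fps_X) * y v =
      fps_X * (of_nat (card (neighbours v)) * y v - (\<Sum>s\<in>neighbours v. a s))" for v
  proof -
    \<comment> \<open>The constant coefficient vanishes because all extension counts at
      \<open>r = 0\<close> are 1; the others are \<open>neighbour_excess_Suc\<close>.\<close>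
    have "y v = fps_X * ((of_nat (card (neighbours v)) - 2) * y v - (\<Sum>s\<in>neighbours v. a s))"
    proof (rule fps_ext)
      have c: "of_nat (card (neighbours v)) - 2 = fps_const (int (card (neighbours v)) - 2)"
        by (simp add: fps_of_nat[symmetric] numeral_fps_const fps_const_sub)
      show "fps_nth (y v) r = fps_nth (fps_X * ((of_nat (card (neighbours v)) - 2) * y v
          - (\<Sum>s\<in>neighbours v. a s))) r" for r
        unfolding c
        by (cases r) (simp_all add: neighbour_excess_Suc[OF tri] fps_sum_nth a_def y_def,
            simp add: neighbour_excess_def)
    qed
    then show ?thesis by (simp add: algebra_simps)
  qed
  show thesis
  proof (rule that[of y])
    have "(1 + fps_X) * (F - 1) = fps_X * (\<Sum>v\<in>pverts \<Gamma>. (1 + fps_X) * a v)"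
      by (subst F_eq) (simp add: sum_distrib_left[symmetric])
    also have "(\<Sum>v\<in>pverts \<Gamma>. (1 + fps_X) * a v) =
        of_nat (card (pverts \<Gamma>)) * F + fps_X * (\<Sum>v\<in>pverts \<Gamma>. y v)"
      by (simp add: a_eq sum.distrib sum_distrib_left)
    finally show "(1 + fps_X) * (F - 1) =
        fps_X * (of_nat (card (pverts \<Gamma>)) * F + fps_X * (\<Sum>v\<in>pverts \<Gamma>. y v))" .
  next
    fix v assume "v \<in> pverts \<Gamma>"
    have "(\<Sum>s\<in>neighbours v. (1 + fps_X) * a s) =
        of_nat (card (neighbours v)) * F + fps_X * (\<Sum>s\<in>neighbours v. y s)"
      by (simp add: a_eq sum.distrib sum_distrib_left)
    then have s: "(1 + fps_X) * (\<Sum>s\<in>neighbours v. a s) =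
        of_nat (card (neighbours v)) * F + fps_X * (\<Sum>s\<in>neighbours v. y s)"
      by (simp add: sum_distrib_left)
    have "(1 + fps_X) * ((1 + 2 * fps_X) * y v) =
        fps_X * ((1 + fps_X) * of_nat (card (neighbours v)) * y v
          - (1 + fps_X) * (\<Sum>s\<in>neighbours v. a s))"
      unfolding y_eq by (simp add: algebra_simps)
    then show "(1 + fps_X) * (1 + 2 * fps_X) * y v
        - fps_X * (1 + fps_X) * of_nat (card (neighbours v)) * y v
        + fps_X ^ 2 * (\<Sum>s\<in>neighbours v. y s) = - fps_X * F * of_nat (card (neighbours v))"
      unfolding s by (simp add: algebra_simps power2_eq_square)
  qed
qed

end

section \<open>The pencil of a graph and transport of its solutions\<close>

definition pencil :: "'a::comm_ring_1 \<Rightarrow> ('v \<Rightarrow> 'v set) \<Rightarrow> ('v \<Rightarrow> 'a) \<Rightarrow> 'v \<Rightarrow> 'a" where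
  "pencil x N h v = (1 + x) * (1 + 2 * x) * h v - x * (1 + x) * of_nat (card (N v)) * h v
     + x ^ 2 * (\<Sum>s\<in>N v. h s)"

text \<open>Both sides sum over ordered pairs of adjacent vertices: the adjacency operator is
  self-adjoint.\<close>

lemma sum_neighbours_swap:
  fixes h g :: "'v \<Rightarrow> 'a::comm_ring_1"
  assumes "finite V" "\<And>v. v \<in> V \<Longrightarrow> N v \<subseteq> V"
    and "\<And>u v. u \<in> V \<Longrightarrow> v \<in> V \<Longrightarrow> u \<in> N v \<longleftrightarrow> v \<in> N u"
  shows "(\<Sum>v\<in>V. h v * (\<Sum>s\<in>N v. g s)) = (\<Sum>v\<in>V. g v * (\<Sum>s\<in>N v. h s))"
proof -
  have *: "(\<Sum>s\<in>N v. f s) = (\<Sum>s\<in>V. if s \<in> N v then f s else 0)" if "v \<in> V" for v and f :: "'v \<Rightarrow> 'a"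
    using assms(1) assms(2)[OF that] by (simp add: sum.inter_restrict[symmetric] Int_absorb1)
  have **: "q v * (\<Sum>s\<in>N v. f s) = (\<Sum>s\<in>V. if s \<in> N v then q v * f s else 0)"
    if "v \<in> V" for v and q f :: "'v \<Rightarrow> 'a"
    unfolding *[OF that] sum_distrib_left by (intro sum.cong) auto
  have "(\<Sum>v\<in>V. h v * (\<Sum>s\<in>N v. g s)) = (\<Sum>v\<in>V. \<Sum>s\<in>V. if s \<in> N v then h v * g s else 0)"
    by (intro sum.cong[OF HOL.refl] **)
  also have "\<dots> = (\<Sum>s\<in>V. \<Sum>v\<in>V. if s \<in> N v then h v * g s else 0)" by (rule sum.swap)
  also have "\<dots> = (\<Sum>s\<in>V. \<Sum>v\<in>V. if v \<in> N s then g s * h v else 0)"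
    by (intro sum.cong HOL.refl) (auto simp: assms(3) mult.commute)
  also have "\<dots> = (\<Sum>v\<in>V. g v * (\<Sum>s\<in>N v. h s))"
    by (intro sum.cong[OF HOL.refl] **[symmetric])
  finally show ?thesis .
qed

lemma pencil_symmetric:
  fixes h g :: "'v \<Rightarrow> 'a::comm_ring_1"
  assumes "finite V" "\<And>v. v \<in> V \<Longrightarrow> N v \<subseteq> V"
    and "\<And>u v. u \<in> V \<Longrightarrow> v \<in> V \<Longrightarrow> u \<in> N v \<longleftrightarrow> v \<in> N u"
  shows "(\<Sum>v\<in>V. h v * pencil x N g v) = (\<Sum>v\<in>V. g v * pencil x N h v)"
proof -
  have *: "(\<Sum>v\<in>V. p v * pencil x N q v) =
      (\<Sum>v\<in>V. p v * q v * ((1 + x) * (1 + 2 * x) - x * (1 + x) * of_nat (card (N v))))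
      + x ^ 2 * (\<Sum>v\<in>V. p v * (\<Sum>s\<in>N v. q s))" for p q :: "'v \<Rightarrow> 'a"
  proof -
    have "p v * pencil x N q v =
        p v * q v * ((1 + x) * (1 + 2 * x) - x * (1 + x) * of_nat (card (N v)))
        + x ^ 2 * (p v * (\<Sum>s\<in>N v. q s))" for v
      by (simp add: pencil_def algebra_simps)
    then show ?thesis by (simp only: sum.distrib sum_distrib_left[symmetric])
  qed
  show ?thesis
    using sum_neighbours_swap[OF assms, of h g] unfolding * by (simp add: mult.commute)
qed

text \<open>Summing the equations \<open>pencil X N y v = - X F d(v)\<close> expresses \<open>\<Sum> y\<close> through \<open>\<Sum> d y\<close>,
  so that symmetry of the pencil compares the right-hand sides of two such systems.\<close>

lemma sum_pencil:
  fixes h :: "'v \<Rightarrow> 'a::comm_ring_1"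
  assumes "finite V" "\<And>v. v \<in> V \<Longrightarrow> N v \<subseteq> V"
    and "\<And>u v. u \<in> V \<Longrightarrow> v \<in> V \<Longrightarrow> u \<in> N v \<longleftrightarrow> v \<in> N u"
  shows "(\<Sum>v\<in>V. pencil x N h v) =
    (1 + x) * (1 + 2 * x) * (\<Sum>v\<in>V. h v) - x * (\<Sum>v\<in>V. of_nat (card (N v)) * h v)"
proof -
  \<comment> \<open>On the constant 1 the adjacency term is \<open>x^2\<close> times the degree,
    which combines with the degree term to \<open>- x\<close> times the degree.\<close>
  have "pencil x N (\<lambda>_. 1) v = (1 + x) * (1 + 2 * x) - x * of_nat (card (N v))" for v
    by (simp add: pencil_def algebra_simps power2_eq_square)
  then have "(\<Sum>v\<in>V. pencil x N h v) =
      (\<Sum>v\<in>V. h v * ((1 + x) * (1 + 2 * x) - x * of_nat (card (N v))))"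
    using pencil_symmetric[OF assms, of "\<lambda>_. 1" x h] by simp
  moreover have "h v * ((1 + x) * (1 + 2 * x) - x * of_nat (card (N v))) =
      (1 + x) * (1 + 2 * x) * h v - x * (of_nat (card (N v)) * h v)" for v
    by (simp add: algebra_simps)
  ultimately show ?thesis by (simp only: sum_subtractf sum_distrib_left[symmetric])
qed

text \<open>Pairing \<open>w\<close> with \<open>y1\<close> by symmetry compares their
  degree-weighted sums, and \<open>sum_pencil\<close> turns this into
  \<open>F1 \<Sum>y2 = F2 \<Sum>y1\<close>. Cross-multiplying the equations for \<open>F1\<close>
  and \<open>F2\<close> then leaves \<open>(1 + x) (F2 - F1) = 0\<close>.\<close>

lemma growth_eq_of_pencil_systems:
  fixes F1 F2 x p :: "'a::idom" and y1 y2 w :: "'v \<Rightarrow> 'a"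
  assumes fin: "finite V" and N: "\<And>v. v \<in> V \<Longrightarrow> N v \<subseteq> V"
    "\<And>u v. u \<in> V \<Longrightarrow> v \<in> V \<Longrightarrow> u \<in> N v \<longleftrightarrow> v \<in> N u"
    and y1: "\<And>v. v \<in> V \<Longrightarrow> pencil x N y1 v = - x * F1 * of_nat (card (N v))"
    and w: "\<And>v. v \<in> V \<Longrightarrow> pencil x N w v = - p * x * F2 * of_nat (card (N v))"
    and sum_w: "(\<Sum>v\<in>V. w v) = p * (\<Sum>v\<in>V. y2 v)"
    and F1: "(1 + x) * (F1 - 1) = x * (of_nat (card V) * F1 + x * (\<Sum>v\<in>V. y1 v))"
    and F2: "(1 + x) * (F2 - 1) = x * (of_nat (card V) * F2 + x * (\<Sum>v\<in>V. y2 v))"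
    and nonzero: "x \<noteq> 0" "1 + x \<noteq> 0" "1 + 2 * x \<noteq> 0" "p \<noteq> 0"
  shows "F1 = F2"
proof -
  let ?d = "\<lambda>v. of_nat (card (N v)) :: 'a"
  let ?c = "(1 + x) * (1 + 2 * x)"
  have "(\<Sum>v\<in>V. w v * pencil x N y1 v) = (\<Sum>v\<in>V. y1 v * pencil x N w v)"
    by (rule pencil_symmetric[OF fin N])
  then have "- x * (F1 * (\<Sum>v\<in>V. ?d v * w v)) = - x * (p * F2 * (\<Sum>v\<in>V. ?d v * y1 v))"
    by (simp add: y1 w sum_distrib_left sum_negf algebra_simps)
  then have dw: "F1 * (\<Sum>v\<in>V. ?d v * w v) = p * F2 * (\<Sum>v\<in>V. ?d v * y1 v)"
    using nonzero by simp
  have s1: "?c * (\<Sum>v\<in>V. y1 v) = x * (\<Sum>v\<in>V. ?d v * y1 v) - x * F1 * (\<Sum>v\<in>V. ?d v)"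
    using sum_pencil[OF fin N, of x y1] y1 by (simp add: sum_distrib_left sum_negf algebra_simps)
  have sw: "?c * (\<Sum>v\<in>V. w v) = x * (\<Sum>v\<in>V. ?d v * w v) - p * x * F2 * (\<Sum>v\<in>V. ?d v)"
    using sum_pencil[OF fin N, of x w] w by (simp add: sum_distrib_left sum_negf algebra_simps)
  have "?c * (F1 * (\<Sum>v\<in>V. w v)) = F1 * (?c * (\<Sum>v\<in>V. w v))" by simp
  also have "\<dots> = x * (F1 * (\<Sum>v\<in>V. ?d v * w v)) - p * x * F1 * F2 * (\<Sum>v\<in>V. ?d v)"
    unfolding sw by (simp add: algebra_simps)
  also have "\<dots> = p * F2 * (?c * (\<Sum>v\<in>V. y1 v))"
    unfolding dw s1 by (simp add: algebra_simps)
  also have "\<dots> = ?c * (p * F2 * (\<Sum>v\<in>V. y1 v))" by simp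
  finally have "F1 * (p * (\<Sum>v\<in>V. y2 v)) = p * F2 * (\<Sum>v\<in>V. y1 v)"
    using nonzero by (simp add: sum_w)
  then have *: "F1 * (\<Sum>v\<in>V. y2 v) = F2 * (\<Sum>v\<in>V. y1 v)"
    using nonzero by (simp add: mult.left_commute mult.assoc)
  have "F1 * ((1 + x) * (F2 - 1)) - F2 * ((1 + x) * (F1 - 1)) =
      x ^ 2 * (F1 * (\<Sum>v\<in>V. y2 v) - F2 * (\<Sum>v\<in>V. y1 v))"
    unfolding F1 F2 by (simp add: algebra_simps power2_eq_square)
  then have "(1 + x) * (F2 - F1) = 0" unfolding * by (simp add: algebra_simps)
  then show ?thesis using nonzero by simp
qed

text \<open>The pendant leaves \<open>L\<close> are attached to \<open>T\<close> at \<open>b\<close> in the first system and at \<open>c\<close> in the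
  second. A vector \<open>g\<close> on \<open>T\<close> with \<open>pencil x N g = p (e\<^sub>b - e\<^sub>c)\<close> transports the second solution
  to a solution \<open>p y2 + k g\<close> of the first system.\<close>

lemma growth_eq_of_moved_leaves:
  fixes F1 F2 x p :: "'a::idom" and y1 y2 g :: "'v \<Rightarrow> 'a"
  assumes fin: "finite T" "finite L" and disj: "T \<inter> L = {}"
    and N: "\<And>v. v \<in> T \<Longrightarrow> N v \<subseteq> T" "\<And>u v. u \<in> T \<Longrightarrow> v \<in> T \<Longrightarrow> u \<in> N v \<longleftrightarrow> v \<in> N u"
    and bc: "b \<in> T" "c \<in> T" "b \<noteq> c"
    and N1: "\<And>v. N1 v = (if v \<in> L then {b} else if v = b then N b \<union> L else N v)"
    and N2: "\<And>v. N2 v = (if v \<in> L then {c} else if v = c then N c \<union> L else N v)"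
    and y1: "\<And>v. v \<in> T \<union> L \<Longrightarrow> pencil x N1 y1 v = - x * F1 * of_nat (card (N1 v))"
    and y2: "\<And>v. v \<in> T \<union> L \<Longrightarrow> pencil x N2 y2 v = - x * F2 * of_nat (card (N2 v))"
    and F1: "(1 + x) * (F1 - 1) = x * (of_nat (card (T \<union> L)) * F1 + x * (\<Sum>v\<in>T \<union> L. y1 v))"
    and F2: "(1 + x) * (F2 - 1) = x * (of_nat (card (T \<union> L)) * F2 + x * (\<Sum>v\<in>T \<union> L. y2 v))"
    and nonzero: "x \<noteq> 0" "1 + x \<noteq> 0" "1 + 2 * x \<noteq> 0" "p \<noteq> 0"
    and g: "\<And>v. v \<in> T \<Longrightarrow> pencil x N g v = (if v = b then p else if v = c then - p else 0)"
    and sum_g: "(\<Sum>v\<in>T. g v) = 0" and gbc: "g b + g c = 0"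
  shows "F1 = F2"
proof -
  define m where "m = (of_nat (card L) :: 'a)"
  \<comment> \<open>The defect of \<open>y2\<close> at \<open>c\<close> when the pencil of the bare
    graph on \<open>T\<close> replaces that of the second graph; see \<open>y2T\<close>.\<close>
  define k where "k = x * (1 + x) * m * y2 c - x ^ 2 * (\<Sum>v\<in>L. y2 v) - x * F2 * m"
  define w where "w v = (if v \<in> T then p * y2 v + k * g v else p * y2 v)" for v
  have fN: "finite (N v)" if "v \<in> T" for v using N(1)[OF that] fin finite_subset by blast
  have NL: "N v \<inter> L = {}" if "v \<in> T" for v using N(1)[OF that] disj by blast
  have cT: "c \<notin> L" "b \<notin> L" using bc disj by blast+
  have pencil_leaf: "pencil x M h v = (1 + x) * (1 + 2 * x) * h v - x * (1 + x) * h v + x ^ 2 * h r"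
    if "M v = {r}" for M h v r
    using that by (simp add: pencil_def)
  have pencil_root: "pencil x M h r = pencil x N h r - x * (1 + x) * m * h r + x ^ 2 * (\<Sum>v\<in>L. h v)"
    if "M r = N r \<union> L" "r \<in> T" for M h r
    using that fN[OF that(2)] fin NL[OF that(2)]
    by (simp add: pencil_def card_Un_disjoint sum.union_disjoint m_def algebra_simps)
  have pencil_other: "pencil x M h v = pencil x N h v" if "M v = N v" for M h v
    using that by (simp add: pencil_def)
  have card1: "of_nat (card (N1 b)) = of_nat (card (N b)) + m"
    using fN[of b] fin NL[of b] bc cT by (simp add: N1 card_Un_disjoint m_def)
  have card2: "of_nat (card (N2 c)) = of_nat (card (N c)) + m"
    using fN[of c] fin NL[of c] bc cT by (simp add: N2 card_Un_disjoint m_def)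
  have y2T: "pencil x N y2 v = - x * F2 * of_nat (card (N v)) + (if v = c then k else 0)"
    if "v \<in> T" for v
  proof (cases "v = c")
    case True
    have "pencil x N2 y2 c = pencil x N y2 c - x * (1 + x) * m * y2 c + x ^ 2 * (\<Sum>v\<in>L. y2 v)"
      using cT bc by (intro pencil_root) (simp_all add: N2)
    then show ?thesis
      using y2[of c] bc card2 True by (simp add: k_def algebra_simps)
  next
    case False
    have "N2 v = N v" using False that disj by (auto simp: N2)
    then show ?thesis using y2[of v] that False pencil_other[of N2 v y2] by simp
  qed
  have sum_dg: "x * (\<Sum>v\<in>T. of_nat (card (N v)) * g v) = 0"
  proof -
    have "(\<Sum>v\<in>T. pencil x N g v) = (\<Sum>v\<in>T. (if v = b then p else 0) - (if v = c then p else 0))"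
      using bc by (intro sum.cong) (auto simp: g)
    also have "\<dots> = 0" using bc fin by (simp add: sum_subtractf)
    finally show ?thesis using sum_pencil[OF fin(1) N, of x g] sum_g by simp
  qed
  \<comment> \<open>Pairing \<open>y2\<close> with \<open>g\<close> yields
    \<open>p (y2 b - y2 c) = k g c\<close>, hence \<open>w b = p y2 c\<close>: the leaves at
    \<open>b\<close> see the same value at their root as those at \<open>c\<close> did, up to the
    factor \<open>p\<close>.\<close>
  have "(\<Sum>v\<in>T. y2 v * pencil x N g v) = (\<Sum>v\<in>T. g v * pencil x N y2 v)"
    by (rule pencil_symmetric[OF fin(1) N])
  moreover have "(\<Sum>v\<in>T. y2 v * pencil x N g v) =
      (\<Sum>v\<in>T. (if v = b then p * y2 v else 0) - (if v = c then p * y2 v else 0))"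
    using bc by (intro sum.cong) (auto simp: g)
  moreover have "\<dots> = p * y2 b - p * y2 c" using bc fin by (simp add: sum_subtractf)
  moreover have "(\<Sum>v\<in>T. g v * pencil x N y2 v) =
      (\<Sum>v\<in>T. - F2 * (x * (of_nat (card (N v)) * g v)) + (if v = c then k * g v else 0))"
    by (intro sum.cong) (auto simp: y2T algebra_simps)
  moreover have "\<dots> = - F2 * (x * (\<Sum>v\<in>T. of_nat (card (N v)) * g v)) + k * g c"
    by (simp only: sum.distrib sum_distrib_left[symmetric]) (use bc fin in simp)
  ultimately have "p * y2 b - p * y2 c = k * g c" using sum_dg by simp
  moreover have "g c = - g b" using gbc by (simp add: eq_neg_iff_add_eq_0 add.commute)
  ultimately have wb: "w b = p * y2 c" using bc by (simp add: w_def algebra_simps)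
  have w_lin: "pencil x N w v = p * pencil x N y2 v + k * pencil x N g v" if "v \<in> T" for v
  proof -
    have "(\<Sum>s\<in>N v. w s) = p * (\<Sum>s\<in>N v. y2 s) + k * (\<Sum>s\<in>N v. g s)"
      unfolding sum_distrib_left sum.distrib[symmetric]
      using N(1)[OF that] by (intro sum.cong) (auto simp: w_def)
    then show ?thesis using that by (simp add: pencil_def w_def algebra_simps)
  qed
  have wL: "w v = p * y2 v" if "v \<in> L" for v using that disj by (auto simp: w_def)
  show ?thesis
  proof (rule growth_eq_of_pencil_systems[where V = "T \<union> L" and N = N1 and w = w and ?y1.0 = y1 and ?y2.0 = y2])
    show "N1 v \<subseteq> T \<union> L" if "v \<in> T \<union> L" for v
      using that N(1) bc by (auto simp: N1)
    show "u \<in> N1 v \<longleftrightarrow> v \<in> N1 u" if "u \<in> T \<union> L" "v \<in> T \<union> L" for u v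
      using that N(1)[of u] N(1)[of v] N(2)[of u v] bc disj by (auto simp: N1)
    show "pencil x N1 w v = - p * x * F2 * of_nat (card (N1 v))" if v: "v \<in> T \<union> L" for v
    proof -
      consider "v \<in> L" | "v = b" | "v \<in> T" "v \<noteq> b" using v by blast
      then show ?thesis
      proof cases
        case 1
        have "pencil x N1 w v = p * pencil x N2 y2 v"
          using 1 wL[OF 1] wb pencil_leaf[of N1 v b w] pencil_leaf[of N2 v c y2]
          by (simp add: N1 N2 algebra_simps)
        then show ?thesis using y2[of v] 1 by (simp add: N1 N2 mult_ac)
      next
        case 2
        \<comment> \<open>The term \<open>k p\<close> coming from \<open>g\<close> supplies exactly
          the contribution of the leaves at \<open>b\<close>. At \<open>c\<close>, in the next case,
          the opposite term removes the defect of \<open>p y2\<close>.\<close>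
        have "pencil x N1 w b = pencil x N w b - x * (1 + x) * m * w b + x ^ 2 * (\<Sum>v\<in>L. w v)"
          using cT bc by (intro pencil_root) (simp_all add: N1)
        also have "(\<Sum>v\<in>L. w v) = p * (\<Sum>v\<in>L. y2 v)" by (simp add: wL sum_distrib_left)
        finally show ?thesis
          using 2 bc card1 by (simp add: w_lin wb y2T g) (simp add: k_def algebra_simps)
      next
        case 3
        then have "N1 v = N v" using disj by (auto simp: N1)
        then show ?thesis
          using 3 pencil_other[of N1 v w]
          by (cases "v = c") (simp_all add: w_lin y2T g algebra_simps)
      qed
    qed
    have "(\<Sum>v\<in>T. w v) = p * (\<Sum>v\<in>T. y2 v) + k * (\<Sum>v\<in>T. g v)"
      by (simp add: w_def sum.distrib sum_distrib_left)
    then show "(\<Sum>v\<in>T \<union> L. w v) = p * (\<Sum>v\<in>T \<union> L. y2 v)"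
      using fin disj by (simp add: sum.union_disjoint wL sum_g sum_distrib_left distrib_left)
  qed (use fin y1 F1 F2 nonzero in auto)
qed


section \<open>Trees given by parents, and isomorphisms\<close>

text \<open>Vertex 0 is the root. The condition \<open>q i < i\<close>, assumed below, makes every
  such graph a tree.\<close>

definition parent_graph :: "nat \<Rightarrow> (nat \<Rightarrow> nat) \<Rightarrow> nat pair_pre_digraph" where
  "parent_graph n q = \<lparr> pverts = {..<n},
     parcs = {(u, v). u < n \<and> v < n \<and> (0 < u \<and> v = q u \<or> 0 < v \<and> u = q v)} \<rparr>"

lemma pverts_parent_graph [simp]: "pverts (parent_graph n q) = {..<n}"
  by (simp add: parent_graph_def)

lemma in_parcs_parent_graph:
  "(u, v) \<in> parcs (parent_graph n q) \<longleftrightarrow> u < n \<and> v < n \<and> (0 < u \<and> v = q u \<or> 0 < v \<and> u = q v)"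
  by (simp add: parent_graph_def)

lemma pcas_nth:
  assumes "pcas u p v" "i < length p"
  shows "fst (p ! i) = (if i = 0 then u else snd (p ! (i - 1)))"
  using assms by (induction u p v arbitrary: i rule: pcas.induct) (auto simp: nth_Cons split: nat.split)

lemma pcas_last:
  assumes "pcas u p v" "p \<noteq> []"
  shows "snd (last p) = v"
  using assms by (induction u p v rule: pcas.induct) (auto split: if_splits)

context
  fixes n :: nat and q :: "nat \<Rightarrow> nat"
  assumes n_pos: "0 < n" and parent_less: "\<And>i. 0 < i \<Longrightarrow> q i < i"
begin

lemma pair_graph_parent_graph: "pair_graph (parent_graph n q)"
proof -
  have "finite (parcs (parent_graph n q))"
    by (rule finite_subset[of _ "{..<n} \<times> {..<n}"]) (auto simp: parent_graph_def)
  moreover have "symmetric (with_proj (parent_graph n q))"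
    by (auto simp: symmetric_def in_parcs_parent_graph intro!: symI)
  moreover have "b \<noteq> q b" if "0 < b" for b using parent_less[OF that] by simp
  ultimately show ?thesis
    by unfold_locales (auto simp: in_parcs_parent_graph)
qed

lemma connected_parent_graph: "Digraph_Component.connected (with_proj (parent_graph n q))"
proof -
  interpret pair_graph "parent_graph n q" by (rule pair_graph_parent_graph)
  have to0: "v \<rightarrow>\<^sup>*\<^bsub>with_proj (parent_graph n q)\<^esub> 0" if "v < n" for v
    using that
  proof (induction v rule: less_induct)
    case (less v)
    show ?case
    proof (cases "v = 0")
      case True
      then show ?thesis using n_pos reachable_refl[of 0] by simp
    next
      case False
      then have "q v < v" using parent_less by simp
      then have "(v, q v) \<in> parcs (parent_graph n q)"
        using less.prems False by (simp add: in_parcs_parent_graph)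
      then show ?thesis
        using less.IH[of "q v"] \<open>q v < v\<close> less.prems by (intro adj_reachable_trans[of v "q v"]) auto
    qed
  qed
  have "u \<rightarrow>\<^sup>*\<^bsub>with_proj (parent_graph n q)\<^esub> v" if "u < n" "v < n" for u v
    using to0[OF that(1)] to0[OF that(2)] symmetric_reachable[OF sym_arcs] reachable_trans by blast
  then show ?thesis
    using n_pos unfolding connected_def
    by (intro strongly_connectedI) (auto simp: reachable_mk_symmetric_eq[OF sym_arcs])
qed

text \<open>On a cycle of length at least 3 both neighbours of the largest vertex would be its parent.\<close>

lemma acyclic_parent_graph:
  "\<not> (\<exists>p. pre_digraph.cycle (with_proj (parent_graph n q)) p \<and> length p \<ge> 3)"
proof
  interpret pair_graph "parent_graph n q" by (rule pair_graph_parent_graph)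
  assume "\<exists>p. pre_digraph.cycle (with_proj (parent_graph n q)) p \<and> length p \<ge> 3"
  then obtain p u where walk: "awalk u p u" and dist: "distinct (tl (pawalk_verts u p))"
    and len: "length p \<ge> 3"
    unfolding cycle_def by auto
  define k where "k = length p"
  define vs where "vs = map snd p"
  have cas: "pcas u p u" and arcs: "set p \<subseteq> parcs (parent_graph n q)"
    using walk by (auto simp: awalk_def)
  have "pawalk_verts u p = fst (hd p) # vs"
    using awalk_verts_conv'[of u p u] cas len by (auto simp: vs_def)
  then have dvs: "distinct vs" using dist by simp
  have len_vs: "length vs = k" and k: "k \<ge> 3" using len by (simp_all add: vs_def k_def)
  obtain i where i: "i < k" "vs ! i = Max (set vs)"
    using Max_in[of "set vs"] len_vs k by (metis List.finite_set in_set_conv_nth list.size(3) not_numeral_le_zero set_empty)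
  have max: "vs ! j \<le> vs ! i" if "j < k" for j
    using that len_vs i by simp
  \<comment> \<open>The cyclic predecessor and successor of \<open>i\<close>; they differ because
    the cycle has length at least 3.\<close>
  define j where "j = (if i = 0 then k - 1 else i - 1)"
  define l where "l = (if i = k - 1 then 0 else i + 1)"
  have jl: "j < k" "l < k" "j \<noteq> l" using i k by (auto simp: j_def l_def)
  have last: "vs ! (k - 1) = u"
    using pcas_last[OF cas] k last_conv_nth[of p] by (cases "p = []") (auto simp: vs_def k_def)
  have arc: "(fst (p ! h), vs ! h) \<in> parcs (parent_graph n q)" if "h < k" for h
    using arcs that nth_mem[of h p] by (auto simp: vs_def k_def)
  have "fst (p ! i) = vs ! j"
    using pcas_nth[OF cas, of i] i last by (auto simp: j_def vs_def k_def)
  then have a: "(vs ! j, vs ! i) \<in> parcs (parent_graph n q)" using arc[OF i(1)] by simp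
  have "fst (p ! l) = vs ! i"
    using pcas_nth[OF cas, of l] i jl last by (auto simp: l_def vs_def k_def)
  then have b: "(vs ! i, vs ! l) \<in> parcs (parent_graph n q)" using arc[OF jl(2)] by simp
  have "vs ! j = q (vs ! i)" using a max[OF jl(1)] parent_less[of "vs ! j"]
    by (auto simp: in_parcs_parent_graph)
  moreover have "vs ! l = q (vs ! i)" using b max[OF jl(2)] parent_less[of "vs ! l"]
    by (auto simp: in_parcs_parent_graph)
  ultimately show False using dvs jl len_vs nth_eq_iff_index_eq[of vs j l] by simp
qed

lemma tree_graph_parent_graph: "tree_graph (parent_graph n q)"
  unfolding tree_graph_def
  using pair_graph_parent_graph connected_parent_graph acyclic_parent_graph by blast

lemma triangle_free_parent_graph:
  assumes "(a, b) \<in> parcs (parent_graph n q)" "(a, c) \<in> parcs (parent_graph n q)"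
    "(b, c) \<in> parcs (parent_graph n q)"
  shows False
  using assms parent_less[of a] parent_less[of b] parent_less[of c]
  by (auto simp: in_parcs_parent_graph)

end

section \<open>Isomorphisms and an invariant\<close>

text \<open>Tail and head are \<open>fst\<close> and \<open>snd\<close> in both digraphs, which
  forces the arc map to be induced by the vertex map.\<close>

lemma digraph_iso_with_projE:
  assumes "digraph_iso (with_proj \<Gamma>) (with_proj \<Delta>)"
  obtains \<phi> where "inj_on \<phi> (pverts \<Gamma>)" "\<phi> ` pverts \<Gamma> = pverts \<Delta>"
    "\<And>u v. u \<in> pverts \<Gamma> \<Longrightarrow> v \<in> pverts \<Gamma> \<Longrightarrow> (\<phi> u, \<phi> v) \<in> parcs \<Delta> \<longleftrightarrow> (u, v) \<in> parcs \<Gamma>"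
proof -
  obtain f where iso: "pre_digraph.digraph_isomorphism (with_proj \<Gamma>) f"
    and \<Delta>: "with_proj \<Delta> = app_iso f (with_proj \<Gamma>)"
    using assms unfolding digraph_iso_def by blast
  interpret G: wf_digraph "with_proj \<Gamma>"
    using iso by (simp add: pre_digraph.digraph_isomorphism_def)
  have wf: "u \<in> pverts \<Gamma>" "v \<in> pverts \<Gamma>" if "(u, v) \<in> parcs \<Gamma>" for u v
    using that G.wellformed[of "(u, v)"] by simp_all
  let ?\<phi> = "iso_verts f"
  have inj: "inj_on ?\<phi> (pverts \<Gamma>)"
    and ends: "\<And>a. a \<in> parcs \<Gamma> \<Longrightarrow> ?\<phi> (fst a) = iso_tail f (iso_arcs f a) \<and> ?\<phi> (snd a) = iso_head f (iso_arcs f a)"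
    using iso by (simp_all add: G.digraph_isomorphism_def)
  have verts: "?\<phi> ` pverts \<Gamma> = pverts \<Delta>"
    using arg_cong[OF \<Delta>, of verts] by simp
  have "iso_tail f = fst" "iso_head f = snd"
    using arg_cong[OF \<Delta>, of tail] arg_cong[OF \<Delta>, of head] by simp_all
  then have arcs_f: "iso_arcs f a = (?\<phi> (fst a), ?\<phi> (snd a))" if "a \<in> parcs \<Gamma>" for a
    using ends[OF that] by (simp add: prod_eq_iff)
  have "parcs \<Delta> = iso_arcs f ` parcs \<Gamma>"
    using arg_cong[OF \<Delta>, of arcs] by simp
  then have arcs: "parcs \<Delta> = (\<lambda>a. (?\<phi> (fst a), ?\<phi> (snd a))) ` parcs \<Gamma>"
    using arcs_f by simp
  have "(?\<phi> u, ?\<phi> v) \<in> parcs \<Delta> \<longleftrightarrow> (u, v) \<in> parcs \<Gamma>" if "u \<in> pverts \<Gamma>" "v \<in> pverts \<Gamma>" for u v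
  proof
    assume "(?\<phi> u, ?\<phi> v) \<in> parcs \<Delta>"
    then obtain a b where ab: "(a, b) \<in> parcs \<Gamma>" "?\<phi> u = ?\<phi> a" "?\<phi> v = ?\<phi> b"
      unfolding arcs by auto
    then have "u = a" "v = b" using inj_onD[OF inj] that wf by blast+
    then show "(u, v) \<in> parcs \<Gamma>" using ab by simp
  qed (auto simp: arcs image_iff intro!: bexI[of _ "(u, v)"])
  with inj verts show thesis by (rule that)
qed

definition pendant_support :: "'a pair_pre_digraph \<Rightarrow> 'a \<Rightarrow> bool" where
  "pendant_support \<Gamma> v \<longleftrightarrow> (\<exists>l\<in>pverts \<Gamma>. (v, l) \<in> parcs \<Gamma> \<and> (\<forall>w\<in>pverts \<Gamma>. (l, w) \<in> parcs \<Gamma> \<longrightarrow> w = v))"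

text \<open>As \<open>a \<noteq> c\<close> and \<open>b \<noteq> d\<close> exclude backtracking, in
  a tree the two ends are at distance three. The property distinguishes the two trees.\<close>

definition supports_at_distance_three :: "'a pair_pre_digraph \<Rightarrow> bool" where
  "supports_at_distance_three \<Gamma> \<longleftrightarrow>
     (\<exists>a\<in>pverts \<Gamma>. \<exists>b\<in>pverts \<Gamma>. \<exists>c\<in>pverts \<Gamma>. \<exists>d\<in>pverts \<Gamma>.
       (a, b) \<in> parcs \<Gamma> \<and> (b, c) \<in> parcs \<Gamma> \<and> (c, d) \<in> parcs \<Gamma> \<and> a \<noteq> c \<and> b \<noteq> d \<and>
       pendant_support \<Gamma> a \<and> pendant_support \<Gamma> d)"

lemma supports_at_distance_three_iso:
  assumes "digraph_iso (with_proj \<Gamma>) (with_proj \<Delta>)" "supports_at_distance_three \<Gamma>"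
  shows "supports_at_distance_three \<Delta>"
proof -
  obtain \<phi> where inj: "inj_on \<phi> (pverts \<Gamma>)" and verts: "\<phi> ` pverts \<Gamma> = pverts \<Delta>"
    and arcs: "\<And>u v. u \<in> pverts \<Gamma> \<Longrightarrow> v \<in> pverts \<Gamma> \<Longrightarrow> (\<phi> u, \<phi> v) \<in> parcs \<Delta> \<longleftrightarrow> (u, v) \<in> parcs \<Gamma>"
    using digraph_iso_with_projE[OF assms(1)] by blast
  have in_\<Delta>: "\<phi> v \<in> pverts \<Delta>" if "v \<in> pverts \<Gamma>" for v using that verts by blast
  have support: "pendant_support \<Delta> (\<phi> v)" if "pendant_support \<Gamma> v" "v \<in> pverts \<Gamma>" for v
  proof -
    obtain l where l: "l \<in> pverts \<Gamma>" "(v, l) \<in> parcs \<Gamma>" "\<forall>w\<in>pverts \<Gamma>. (l, w) \<in> parcs \<Gamma> \<longrightarrow> w = v"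
      using \<open>pendant_support \<Gamma> v\<close> unfolding pendant_support_def by blast
    have "\<forall>w\<in>pverts \<Delta>. (\<phi> l, w) \<in> parcs \<Delta> \<longrightarrow> w = \<phi> v"
      unfolding verts[symmetric] using l arcs by auto
    then show ?thesis
      using l arcs in_\<Delta> that(2) unfolding pendant_support_def by blast
  qed
  obtain a b c d where "a \<in> pverts \<Gamma>" "b \<in> pverts \<Gamma>" "c \<in> pverts \<Gamma>" "d \<in> pverts \<Gamma>"
    "(a, b) \<in> parcs \<Gamma>" "(b, c) \<in> parcs \<Gamma>" "(c, d) \<in> parcs \<Gamma>" "a \<noteq> c" "b \<noteq> d"
    "pendant_support \<Gamma> a" "pendant_support \<Gamma> d"
    using assms(2) unfolding supports_at_distance_three_def by blast
  then show ?thesis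
    unfolding supports_at_distance_three_def
    by (intro bexI[of _ "\<phi> a"] bexI[of _ "\<phi> b"] bexI[of _ "\<phi> c"] bexI[of _ "\<phi> d"])
      (auto simp: arcs support in_\<Delta> dest: inj_onD[OF inj])
qed


section \<open>The two trees\<close>

text \<open>In this tree on 16 vertices, the vertices 0 and 3 are not similar, but attaching the same
  leaves at 0 or at 3 yields cospectral trees. It was found by a search over rooted trees for limbs in
  the sense of McKay that agree for all combinations of adjacency and degree matrix.\<close>

definition core_parent :: "nat \<Rightarrow> nat" where
  "core_parent i = [0, 0, 1, 2, 3, 4, 5, 4, 7, 1, 9, 10, 0, 12, 13, 13] ! i"

text \<open>A table of adjacency lists that can be evaluated; \<open>core_neighbours_iff\<close>
  checks it against \<open>core_parent\<close>.\<close>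

definition core_neighbours :: "nat \<Rightarrow> nat set" where
  "core_neighbours v = set ([[1, 12],
    [0, 2, 9],
    [1, 3],
    [2, 4],
    [3, 5, 7],
    [4, 6],
    [5],
    [4, 8],
    [7],
    [1, 10],
    [9, 11],
    [10],
    [0, 13],
    [12, 14, 15],
    [13],
    [13]] ! v)"

text \<open>The vertices from 16 on are the leaves attached at \<open>r\<close>; for
  \<open>r < 16\<close> parents remain smaller than their children.\<close>

definition leafy_core :: "nat \<Rightarrow> nat \<Rightarrow> nat pair_pre_digraph" where
  "leafy_core n r = parent_graph n (\<lambda>i. if i < 16 then core_parent i else r)"

lemma pverts_leafy_core: "pverts (leafy_core n r) = {..<n}"
  by (simp add: leafy_core_def)

lemma less_16_cases:
  fixes v :: nat
  assumes "v < 16"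
  obtains "v = 0" | "v = 1" | "v = 2" | "v = 3" | "v = 4" | "v = 5" | "v = 6" | "v = 7"
    | "v = 8" | "v = 9" | "v = 10" | "v = 11" | "v = 12" | "v = 13" | "v = 14" | "v = 15"
proof -
  have "v = 0 \<or> v = 1 \<or> v = 2 \<or> v = 3 \<or> v = 4 \<or> v = 5 \<or> v = 6 \<or> v = 7 \<or>
      v = 8 \<or> v = 9 \<or> v = 10 \<or> v = 11 \<or> v = 12 \<or> v = 13 \<or> v = 14 \<or> v = 15"
    using assms by presburger
  then show thesis by (elim disjE) (fact that)+
qed

lemma core_parent_less: "0 < i \<Longrightarrow> i < 16 \<Longrightarrow> core_parent i < i"
  by (elim less_16_cases) (simp_all add: core_parent_def)

lemma leafy_core_parent_less:
  assumes "r < 16" "0 < i"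
  shows "(if i < 16 then core_parent i else r) < i"
  using assms core_parent_less by auto

lemma core_neighbours_less: "v < 16 \<Longrightarrow> s \<in> core_neighbours v \<Longrightarrow> s < 16"
  by (elim less_16_cases) (auto simp: core_neighbours_def)

lemma core_neighbours_iff:
  assumes "u < 16" "v < 16"
  shows "v \<in> core_neighbours u \<longleftrightarrow> 0 < u \<and> v = core_parent u \<or> 0 < v \<and> u = core_parent v"
proof -
  have "\<forall>u\<in>set [0..<16]. \<forall>v\<in>set [0..<16]. v \<in> core_neighbours u \<longleftrightarrow>
      0 < u \<and> v = core_parent u \<or> 0 < v \<and> u = core_parent v"
    by code_simp
  then show ?thesis using assms by auto
qed

lemma core_neighbours_sym:
  assumes "u < 16" "v < 16"
  shows "u \<in> core_neighbours v \<longleftrightarrow> v \<in> core_neighbours u"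
  unfolding core_neighbours_iff[OF assms] core_neighbours_iff[OF assms(2,1)] by blast

lemma in_parcs_leafy_core:
  assumes "r < 16" "16 \<le> n"
  shows "(u, v) \<in> parcs (leafy_core n r) \<longleftrightarrow> u < n \<and> v < n \<and>
    (if u < 16 then if v < 16 then v \<in> core_neighbours u else u = r else v = r)"
proof -
  have "core_parent i < 16" if "0 < i" "i < 16" for i
    using core_parent_less[OF that] that by simp
  then show ?thesis
    using assms by (auto simp: leafy_core_def in_parcs_parent_graph core_neighbours_iff)
qed

lemma leafy_core_neighbours:
  assumes "r < 16" "16 \<le> n" "v < n"
  shows "{s \<in> pverts (leafy_core n r). (v, s) \<in> parcs (leafy_core n r)} =
    (if v \<in> {16..<n} then {r} else if v = r then core_neighbours r \<union> {16..<n} else core_neighbours v)"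
proof -
  have "s < n" if "v < 16" "s \<in> core_neighbours v" for s
    using core_neighbours_less[OF that] assms by simp
  then show ?thesis
    using assms core_neighbours_less[of v]
    by (auto simp: in_parcs_leafy_core[OF assms(1,2)] pverts_leafy_core)
qed

lemma pair_graph_leafy_core: "r < 16 \<Longrightarrow> 0 < n \<Longrightarrow> pair_graph (leafy_core n r)"
  unfolding leafy_core_def by (intro pair_graph_parent_graph leafy_core_parent_less)

lemma tree_graph_leafy_core: "r < 16 \<Longrightarrow> 0 < n \<Longrightarrow> tree_graph (leafy_core n r)"
  unfolding leafy_core_def by (intro tree_graph_parent_graph leafy_core_parent_less)

lemma triangle_free_leafy_core:
  assumes "r < 16" "0 < n"
  shows "\<not> (\<exists>a b c. (a, b) \<in> parcs (leafy_core n r) \<and> (a, c) \<in> parcs (leafy_core n r) \<and>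
    (b, c) \<in> parcs (leafy_core n r))"
  unfolding leafy_core_def
  using triangle_free_parent_graph[OF assms(2) leafy_core_parent_less[OF assms(1)]] by blast

section \<open>Equality of the growth series\<close>

text \<open>The rational solution of \<open>pencil x core_neighbours h = e\<^sub>0 - e\<^sub>3\<close> in lowest terms is
  \<open>pencil_vector x / pencil_scalar x\<close>.\<close>

definition pencil_vector :: "'a::comm_ring_1 \<Rightarrow> nat \<Rightarrow> 'a" where
  "pencil_vector x v = [1 + 4 * x + 4 * x ^ 2 - 3 * x ^ 3 - 10 * x ^ 4 - 9 * x ^ 5 + 4 * x ^ 7 + x ^ 8,
     - (x ^ 2 + 4 * x ^ 3 + 6 * x ^ 4 + 4 * x ^ 5 - x ^ 6 - 3 * x ^ 7 - x ^ 8),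
     x ^ 2 + 3 * x ^ 3 + 2 * x ^ 4 - x ^ 5 - 3 * x ^ 6 - 2 * x ^ 7 + x ^ 8,
     - (1 + 4 * x + 4 * x ^ 2 - 3 * x ^ 3 - 10 * x ^ 4 - 9 * x ^ 5 + 4 * x ^ 7 + x ^ 8),
     x ^ 2 + 4 * x ^ 3 + 5 * x ^ 4 + x ^ 5 - 3 * x ^ 6 - 2 * x ^ 7 + x ^ 8,
     - (x ^ 4 + 3 * x ^ 5 + 2 * x ^ 6 - x ^ 7 - x ^ 8),
     x ^ 6 + x ^ 7 - x ^ 8,
     - (x ^ 4 + 3 * x ^ 5 + 2 * x ^ 6 - x ^ 7 - x ^ 8),
     x ^ 6 + x ^ 7 - x ^ 8,
     x ^ 4 + 3 * x ^ 5 + 3 * x ^ 6 + x ^ 7 - x ^ 8,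
     - (x ^ 6 + 2 * x ^ 7 + x ^ 8),
     x ^ 8,
     - (x ^ 2 + 3 * x ^ 3 + x ^ 4 - 4 * x ^ 5 - 5 * x ^ 6 - x ^ 7 + 3 * x ^ 8),
     x ^ 4 + 3 * x ^ 5 + 2 * x ^ 6 - x ^ 7 - x ^ 8,
     - (x ^ 6 + x ^ 7 - x ^ 8),
     - (x ^ 6 + x ^ 7 - x ^ 8)] ! v"

definition pencil_scalar :: "'a::comm_ring_1 \<Rightarrow> 'a" where
  "pencil_scalar x = 1 + 5 * x + 8 * x ^ 2 + x ^ 3 - 15 * x ^ 4 - 26 * x ^ 5 - 16 * x ^ 6 + 4 * x ^ 7 + 11 * x ^ 8 + 5 * x ^ 9 - 2 * x ^ 10"

lemma pencil_core:
  assumes "v < 16"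
  shows "pencil x core_neighbours (pencil_vector x) v =
    (if v = 0 then pencil_scalar x else if v = 3 then - pencil_scalar x else 0)"
  using assms
  by (elim less_16_cases) (simp_all add: pencil_def core_neighbours_def pencil_vector_def
      pencil_scalar_def algebra_simps power2_eq_square eval_nat_numeral)

lemma sum_pencil_vector: "(\<Sum>v<16. pencil_vector x v) = 0"
  by (simp add: eval_nat_numeral pencil_vector_def)

lemma leafy_core_geodesic_growth:
  assumes "16 \<le> n"
  shows "racg_geodesic_growth_series (leafy_core n 0) = racg_geodesic_growth_series (leafy_core n 3)"
proof -
  let ?X = "fps_X :: int fps"
  let ?N = "\<lambda>r v. if v \<in> {16..<n} then {r} else if v = r then core_neighbours r \<union> {16..<n}
    else core_neighbours v"
  have V: "{..<16} \<union> {16..<n} = {..<n}" using assms by auto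
  have system: "\<exists>y. (\<forall>v\<in>{..<n}. pencil ?X (?N r) y v = - ?X * racg_geodesic_growth_series (leafy_core n r)
        * of_nat (card (?N r v))) \<and>
      (1 + ?X) * (racg_geodesic_growth_series (leafy_core n r) - 1) =
        ?X * (of_nat (card {..<n}) * racg_geodesic_growth_series (leafy_core n r) + ?X * (\<Sum>v<n. y v))"
    if r: "r < 16" for r
  proof -
    interpret racg_graph "leafy_core n r"
      by (intro racg_graph.intro pair_graph_leafy_core) (use r assms in auto)
    have tri: "\<not> (\<exists>a b c. (a, b) \<in> parcs (leafy_core n r) \<and> (a, c) \<in> parcs (leafy_core n r) \<and>
        (b, c) \<in> parcs (leafy_core n r))"
      by (rule triangle_free_leafy_core[OF r]) (use assms in simp)
    obtain y where y: "\<And>v. v \<in> pverts (leafy_core n r) \<Longrightarrow>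
        (1 + ?X) * (1 + 2 * ?X) * y v - ?X * (1 + ?X) * of_nat (card (neighbours v)) * y v
          + ?X ^ 2 * (\<Sum>s\<in>neighbours v. y s)
        = - ?X * racg_geodesic_growth_series (leafy_core n r) * of_nat (card (neighbours v))"
      "(1 + ?X) * (racg_geodesic_growth_series (leafy_core n r) - 1) = ?X *
        (of_nat (card (pverts (leafy_core n r))) * racg_geodesic_growth_series (leafy_core n r)
          + ?X * (\<Sum>v\<in>pverts (leafy_core n r). y v))"
      using geodesic_growth_linear_system[OF tri] by blast
    have "pencil ?X (?N r) y v =
        - ?X * racg_geodesic_growth_series (leafy_core n r) * of_nat (card (?N r v))" if v: "v < n" for v
    proof -
      have "v \<in> pverts (leafy_core n r)" using v by (simp add: pverts_leafy_core)
      from y(1)[OF this] show ?thesis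
        unfolding pencil_def leafy_core_neighbours[OF r assms v] .
    qed
    moreover have "(1 + ?X) * (racg_geodesic_growth_series (leafy_core n r) - 1) =
        ?X * (of_nat (card {..<n}) * racg_geodesic_growth_series (leafy_core n r) + ?X * (\<Sum>v<n. y v))"
      using y(2) unfolding pverts_leafy_core .
    ultimately show ?thesis by (intro exI[of _ y] conjI ballI) (simp_all only: lessThan_iff)
  qed
  obtain y1 where y1: "\<forall>v\<in>{..<n}. pencil ?X (?N 0) y1 v =
        - ?X * racg_geodesic_growth_series (leafy_core n 0) * of_nat (card (?N 0 v))"
      "(1 + ?X) * (racg_geodesic_growth_series (leafy_core n 0) - 1) =
        ?X * (of_nat (card {..<n}) * racg_geodesic_growth_series (leafy_core n 0) + ?X * (\<Sum>v<n. y1 v))"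
    by (rule exE[OF system[of 0]]) (simp, elim conjE, rule that)
  obtain y2 where y2: "\<forall>v\<in>{..<n}. pencil ?X (?N 3) y2 v =
        - ?X * racg_geodesic_growth_series (leafy_core n 3) * of_nat (card (?N 3 v))"
      "(1 + ?X) * (racg_geodesic_growth_series (leafy_core n 3) - 1) =
        ?X * (of_nat (card {..<n}) * racg_geodesic_growth_series (leafy_core n 3) + ?X * (\<Sum>v<n. y2 v))"
    by (rule exE[OF system[of 3]]) (simp, elim conjE, rule that)
  \<comment> \<open>The scalars \<open>1 + X\<close>, \<open>1 + 2 X\<close> and
    \<open>pencil_scalar X\<close> all have constant coefficient 1.\<close>
  have nz: "f \<noteq> 0" if "fps_nth f 0 \<noteq> 0" for f :: "int fps" using that by auto
  show ?thesis
  proof (rule growth_eq_of_moved_leaves[where T = "{..<16}" and L = "{16..<n}" and x = ?X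
        and N = core_neighbours and b = 0 and c = 3 and ?N1.0 = "?N 0" and ?N2.0 = "?N 3"
        and p = "pencil_scalar ?X" and g = "pencil_vector ?X" and ?y1.0 = y1 and ?y2.0 = y2])
    show "core_neighbours v \<subseteq> {..<16}" if "v \<in> {..<16}" for v
      using that core_neighbours_less by auto
    show "u \<in> core_neighbours v \<longleftrightarrow> v \<in> core_neighbours u" if "u \<in> {..<16}" "v \<in> {..<16}" for u v
      using that core_neighbours_sym[of u v] by simp
    show "1 + ?X \<noteq> 0" "1 + 2 * ?X \<noteq> 0" by (auto intro!: nz)
    show "pencil_scalar ?X \<noteq> 0" by (rule nz) (simp add: pencil_scalar_def)
    show "pencil_vector ?X 0 + pencil_vector ?X 3 = 0" by (simp add: pencil_vector_def)
    show "{..<16} \<inter> {16..<n} = {}" by auto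
    show "pencil ?X (?N 0) y1 v = - ?X * racg_geodesic_growth_series (leafy_core n 0) * of_nat (card (?N 0 v))"
      if "v \<in> {..<16} \<union> {16..<n}" for v
      using that unfolding V by (rule bspec[OF y1(1)])
    show "pencil ?X (?N 3) y2 v = - ?X * racg_geodesic_growth_series (leafy_core n 3) * of_nat (card (?N 3 v))"
      if "v \<in> {..<16} \<union> {16..<n}" for v
      using that unfolding V by (rule bspec[OF y2(1)])
  qed (simp_all add: V y1(2) y2(2) pencil_core sum_pencil_vector)
qed

section \<open>Non-isomorphism of the two trees\<close>

text \<open>The path is 0, 1, 9, 10. Its ends carry the leaves 16, present since
  \<open>17 \<le> n\<close>, and 11.\<close>

lemma supports_at_distance_three_leafy_core_0:
  assumes "17 \<le> n"
  shows "supports_at_distance_three (leafy_core n 0)"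
proof -
  have arc: "(u, v) \<in> parcs (leafy_core n 0) \<longleftrightarrow> u < n \<and> v < n \<and>
      (if u < 16 then if v < 16 then v \<in> core_neighbours u else u = 0 else v = 0)" for u v
    using assms by (intro in_parcs_leafy_core) auto
  have "pendant_support (leafy_core n 0) 0" unfolding pendant_support_def arc pverts_leafy_core
    using assms by (intro bexI[of _ 16]) auto
  moreover have "pendant_support (leafy_core n 0) 10" unfolding pendant_support_def arc pverts_leafy_core
    using assms by (intro bexI[of _ 11]) (auto simp: core_neighbours_def)
  ultimately show ?thesis
    unfolding supports_at_distance_three_def arc pverts_leafy_core
    using assms by (intro bexI[of _ 0] bexI[of _ 1] bexI[of _ 9] bexI[of _ 10])
      (auto simp: core_neighbours_def)
qed

text \<open>The core leaves 6, 8, 11, 14, 15 hang at 5, 7, 10, 13, and the added leaves at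
  3.\<close>

lemma pendant_support_leafy_core_3:
  assumes "16 \<le> n" "v < n" "pendant_support (leafy_core n 3) v"
  shows "v \<in> {3, 5, 7, 10, 13}"
proof -
  have arc: "(u, v) \<in> parcs (leafy_core n 3) \<longleftrightarrow> u < n \<and> v < n \<and>
      (if u < 16 then if v < 16 then v \<in> core_neighbours u else u = 3 else v = 3)" for u v
    using assms by (intro in_parcs_leafy_core) auto
  obtain l where l: "l < n" "(v, l) \<in> parcs (leafy_core n 3)"
    "\<And>w. w < n \<Longrightarrow> (l, w) \<in> parcs (leafy_core n 3) \<Longrightarrow> w = v"
    using assms(3) unfolding pendant_support_def pverts_leafy_core by auto
  show ?thesis
  proof (cases "l < 16")
    case False
    then show ?thesis using l(2) assms(2) by (auto simp: arc core_neighbours_def split: if_splits)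
  next
    case True
    have nb: "\<forall>w\<in>core_neighbours l. w = v"
    proof
      fix w assume w: "w \<in> core_neighbours l"
      then have "w < 16" using core_neighbours_less True by blast
      then have "w < n" "(l, w) \<in> parcs (leafy_core n 3)" using w l(1) True assms(1) by (auto simp: arc)
      then show "w = v" by (rule l(3))
    qed
    have "v < 16 \<or> l = 3" using l(2) True by (auto simp: arc split: if_splits)
    moreover have "l \<noteq> 3" using nb by (auto simp: core_neighbours_def)
    ultimately have "v \<in> core_neighbours l"
      using l(2) True core_neighbours_sym[of v l] by (auto simp: arc split: if_splits)
    then show ?thesis
      using True nb by (elim less_16_cases) (auto simp: core_neighbours_def)
  qed
qed

text \<open>Among the candidates, 3, 5 and 7 are pairwise at distance two, and all other distances
  are at least four.\<close>

lemma not_supports_at_distance_three_leafy_core_3: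
  assumes "16 \<le> n"
  shows "\<not> supports_at_distance_three (leafy_core n 3)"
proof
  assume "supports_at_distance_three (leafy_core n 3)"
  then obtain a b c d where bounds: "a < n" "b < n" "c < n" "d < n"
    and arcs: "(a, b) \<in> parcs (leafy_core n 3)" "(b, c) \<in> parcs (leafy_core n 3)" "(c, d) \<in> parcs (leafy_core n 3)"
    and ne: "a \<noteq> c" "b \<noteq> d"
    and sup: "a \<in> {3, 5, 7, 10, 13}" "d \<in> {3, 5, 7, 10, 13}"
    using pendant_support_leafy_core_3[OF assms]
    unfolding supports_at_distance_three_def pverts_leafy_core by auto
  have arc: "(u, v) \<in> parcs (leafy_core n 3) \<longleftrightarrow> u < n \<and> v < n \<and>
      (if u < 16 then if v < 16 then v \<in> core_neighbours u else u = 3 else v = 3)" for u v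
    using assms by (intro in_parcs_leafy_core) auto
  \<comment> \<open>An added leaf inside the path would force backtracking through 3, so the path
    stays in the core.\<close>
  have b: "b < 16"
  proof (rule ccontr)
    assume "\<not> b < 16"
    then have "a = 3" "c = 3" using arcs(1,2) by (simp_all add: arc split: if_splits)
    then show False using ne by simp
  qed
  have c: "c < 16"
  proof (rule ccontr)
    assume "\<not> c < 16"
    then have "b = 3" "d = 3" using arcs(2,3) by (simp_all add: arc split: if_splits)
    then show False using ne by simp
  qed
  have "a < 16" "d < 16" using sup by auto
  then have core: "b \<in> core_neighbours a" "c \<in> core_neighbours b" "d \<in> core_neighbours c"
    using arcs b c by (simp_all add: arc)
  have "\<forall>a\<in>{3, 5, 7, 10, 13}. \<forall>b\<in>core_neighbours a. \<forall>c\<in>core_neighbours b.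
      \<forall>d\<in>core_neighbours c. a = c \<or> b = d \<or> d \<notin> {3, 5, 7, 10, 13}"
    by code_simp
  then show False using sup core ne by blast
qed


section \<open>Cospectrality\<close>

text \<open>As \<open>Q\<close> is its own inverse, \<open>A = Q B Q\<close>. The detour through the
  rationals is made because the reflection used later has denominator 22.\<close>

lemma char_poly_eq_of_involution:
  fixes A B :: "int mat" and Q :: "rat mat"
  assumes A: "A \<in> carrier_mat n n" and B: "B \<in> carrier_mat n n" and Q: "Q \<in> carrier_mat n n"
    and QQ: "Q * Q = 1\<^sub>m n"
    and AQ: "map_mat of_int A * Q = Q * map_mat of_int B"
  shows "char_poly A = char_poly B"
proof -
  let ?A = "map_mat of_int A :: rat mat" and ?B = "map_mat of_int B :: rat mat"
  have carrier: "?A \<in> carrier_mat n n" "?B \<in> carrier_mat n n" using A B by auto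
  have "?A = ?A * (Q * Q)" using carrier by (simp add: QQ)
  also have "\<dots> = Q * ?B * Q"
    by (simp only: assoc_mult_mat[OF carrier(1) Q Q, symmetric] AQ)
  finally have "similar_mat ?A ?B"
    using carrier Q QQ by (intro similar_matI[where n = n and P = Q and Q = Q]) auto
  then have "char_poly ?A = char_poly ?B" by (rule char_poly_similar)
  moreover have "char_poly (map_mat of_int M :: rat mat) = of_int_poly (char_poly M)"
    if "M \<in> carrier_mat n n" for M
    using that by (rule of_int_hom.char_poly_hom)
  ultimately have "(of_int_poly (char_poly A) :: rat poly) = of_int_poly (char_poly B)"
    using A B by metis
  then show ?thesis by simp
qed

lemma char_poly_mat_eq_of_involution:
  fixes a b :: "nat \<Rightarrow> nat \<Rightarrow> int" and q :: "nat \<Rightarrow> nat \<Rightarrow> rat"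
  assumes "\<And>i j. i < n \<Longrightarrow> j < n \<Longrightarrow> (\<Sum>k<n. q i k * q k j) = (if i = j then 1 else 0)"
    and "\<And>i j. i < n \<Longrightarrow> j < n \<Longrightarrow> (\<Sum>k<n. of_int (a i k) * q k j) = (\<Sum>k<n. q i k * of_int (b k j))"
  shows "char_poly (mat n n (\<lambda>(i, j). a i j)) = char_poly (mat n n (\<lambda>(i, j). b i j))"
proof (rule char_poly_eq_of_involution[where Q = "mat n n (\<lambda>(i, j). q i j)"])
  show "mat n n (\<lambda>(i, j). q i j) * mat n n (\<lambda>(i, j). q i j) = 1\<^sub>m n"
    by (rule eq_matI) (simp_all add: scalar_prod_def assms(1) lessThan_atLeast0[symmetric])
  show "map_mat of_int (mat n n (\<lambda>(i, j). a i j)) * mat n n (\<lambda>(i, j). q i j) =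
      mat n n (\<lambda>(i, j). q i j) * map_mat of_int (mat n n (\<lambda>(i, j). b i j))"
    by (rule eq_matI) (simp_all add: scalar_prod_def assms(2) lessThan_atLeast0[symmetric])
qed simp_all

text \<open>Conjugation by an involution that fixes the all-ones vector also matches the complements.\<close>

lemma cospectral_of_involution:
  fixes q :: "nat \<Rightarrow> nat \<Rightarrow> rat"
  assumes verts: "pverts \<Gamma> = {..<n}" "pverts \<Delta> = {..<n}"
    and loopfree: "\<And>v. (v, v) \<notin> parcs \<Gamma>" "\<And>v. (v, v) \<notin> parcs \<Delta>"
    and inv: "\<And>i j. i < n \<Longrightarrow> j < n \<Longrightarrow> (\<Sum>k<n. q i k * q k j) = (if i = j then 1 else 0)"
    and rows: "\<And>i. i < n \<Longrightarrow> (\<Sum>k<n. q i k) = 1" and columns: "\<And>j. j < n \<Longrightarrow> (\<Sum>k<n. q k j) = 1"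
    and conj: "\<And>i j. i < n \<Longrightarrow> j < n \<Longrightarrow>
      (\<Sum>k<n. of_bool ((i, k) \<in> parcs \<Gamma>) * q k j) = (\<Sum>k<n. q i k * of_bool ((k, j) \<in> parcs \<Delta>))"
  shows "cospectral \<Gamma> \<Delta>" "cospectral (graph_complement \<Gamma>) (graph_complement \<Delta>)"
proof -
  have adj: "adjacency_matrix G = mat n n (\<lambda>(i, j). of_bool ((i, j) \<in> parcs G))"
    if "pverts G = {..<n}" for G :: "nat pair_pre_digraph"
    using that by (intro eq_matI) (auto simp: adjacency_matrix_def lessThan_atLeast0 Let_def)
  show "cospectral \<Gamma> \<Delta>"
    unfolding cospectral_def adj[OF verts(1)] adj[OF verts(2)]
    by (rule char_poly_mat_eq_of_involution[OF inv]) (simp_all only: of_int_of_bool conj)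
  have compl: "of_bool ((i, j) \<in> parcs (graph_complement G)) =
      (1 - (if i = j then 1 else 0) - of_bool ((i, j) \<in> parcs G) :: rat)"
    if "pverts G = {..<n}" "\<And>v. (v, v) \<notin> parcs G" "i < n" "j < n" for i j G
    using that by (auto simp: graph_complement_def)
  have verts': "pverts (graph_complement \<Gamma>) = {..<n}" "pverts (graph_complement \<Delta>) = {..<n}"
    using verts by (simp_all add: graph_complement_def)
  have "(\<Sum>k<n. of_bool ((i, k) \<in> parcs (graph_complement \<Gamma>)) * q k j) =
      (\<Sum>k<n. q i k * of_bool ((k, j) \<in> parcs (graph_complement \<Delta>)))"
    if ij: "i < n" "j < n" for i j
  proof -
    have "(\<Sum>k<n. of_bool ((i, k) \<in> parcs (graph_complement \<Gamma>)) * q k j) =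
        (\<Sum>k<n. q k j - (if i = k then q k j else 0) - of_bool ((i, k) \<in> parcs \<Gamma>) * q k j)"
      using ij by (intro sum.cong) (simp_all add: compl[OF verts(1) loopfree(1)] left_diff_distrib)
    also have "\<dots> = (\<Sum>k<n. q k j) - q i j - (\<Sum>k<n. of_bool ((i, k) \<in> parcs \<Gamma>) * q k j)"
      using ij by (simp only: sum_subtractf) simp
    \<comment> \<open>The complement has adjacency matrix \<open>J - I - A\<close> with
      \<open>J\<close> the all-ones matrix; row and column sums 1 give
      \<open>J Q = J = Q J\<close>.\<close>
    also have "\<dots> = (\<Sum>k<n. q i k) - q i j - (\<Sum>k<n. q i k * of_bool ((k, j) \<in> parcs \<Delta>))"
      using ij by (simp only: rows columns conj)
    also have "\<dots> = (\<Sum>k<n. q i k - (if k = j then q i k else 0) - q i k * of_bool ((k, j) \<in> parcs \<Delta>))"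
      using ij by (simp only: sum_subtractf) simp
    also have "\<dots> = (\<Sum>k<n. q i k * of_bool ((k, j) \<in> parcs (graph_complement \<Delta>)))"
      using ij by (intro sum.cong) (simp_all add: compl[OF verts(2) loopfree(2)] right_diff_distrib)
    finally show ?thesis .
  qed
  then show "cospectral (graph_complement \<Gamma>) (graph_complement \<Delta>)"
    unfolding cospectral_def adj[OF verts'(1)] adj[OF verts'(2)]
    by (intro char_poly_mat_eq_of_involution[OF inv]) (simp_all only: of_int_of_bool)
qed

text \<open>22 times the orthogonal reflection of \<open>\<rat>\<^sup>16\<close> that is \<open>-1\<close> on the cyclic subspace of the
  core adjacency matrix generated by \<open>e\<^sub>0 - e\<^sub>3\<close>; this subspace is orthogonal to the all-ones
  vector and to \<open>e\<^sub>0 + e\<^sub>3\<close>.\<close>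

definition core_reflection :: "int list list" where
  "core_reflection =
    [[0, 0, 0, 22, 0, 0, 0, 0, 0, 0, 0, 0, 0, 0, 0, 0],
     [0, 4, 14, 0, 8, -2, 4, -2, 4, 6, 4, -8, -4, 2, -4, -4],
     [0, 14, 5, 0, -5, 4, 3, 4, 3, -1, -8, 5, 8, -4, -3, -3],
     [22, 0, 0, 0, 0, 0, 0, 0, 0, 0, 0, 0, 0, 0, 0, 0],
     [0, 8, -5, 0, 5, -4, -3, -4, -3, 1, 8, -5, 14, 4, 3, 3],
     [0, -2, 4, 0, -4, 12, -2, -10, -2, 8, -2, 4, 2, 10, 2, 2],
     [0, 4, 3, 0, -3, -2, 15, -2, -7, -5, 4, 3, -4, 2, 7, 7],
     [0, -2, 4, 0, -4, -10, -2, 12, -2, 8, -2, 4, 2, 10, 2, 2],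
     [0, 4, 3, 0, -3, -2, -7, -2, 15, -5, 4, 3, -4, 2, 7, 7],
     [0, 6, -1, 0, 1, 8, -5, 8, -5, 9, 6, -1, -6, -8, 5, 5],
     [0, 4, -8, 0, 8, -2, 4, -2, 4, 6, 4, 14, -4, 2, -4, -4],
     [0, -8, 5, 0, -5, 4, 3, 4, 3, -1, 14, 5, 8, -4, -3, -3],
     [0, -4, 8, 0, 14, 2, -4, 2, -4, -6, -4, 8, 4, -2, 4, 4],
     [0, 2, -4, 0, 4, 10, 2, 10, 2, -8, 2, -4, -2, 12, -2, -2],
     [0, -4, -3, 0, 3, 2, 7, 2, 7, 5, -4, -3, 4, -2, 15, -7],
     [0, -4, -3, 0, 3, 2, 7, 2, 7, 5, -4, -3, 4, -2, -7, 15]]"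

text \<open>Up to the factor 22, the table is an involution (\<open>484 = 22^2\<close>) that
  commutes with the adjacency matrix of the core.\<close>

lemma core_reflection_products:
  assumes "i < 16" "j < 16"
  shows "(\<Sum>k<16. core_reflection ! i ! k * core_reflection ! k ! j) = (if i = j then 484 else 0)"
    and "(\<Sum>k<16. of_bool (k \<in> core_neighbours i) * core_reflection ! k ! j) =
      (\<Sum>k<16. core_reflection ! i ! k * of_bool (k \<in> core_neighbours j))"
proof -
  let ?sum = "\<lambda>f. sum_list (map f [0..<16]) :: int"
  \<comment> \<open>Sums over lists, unlike sums over sets, are evaluated directly by
    \<open>code_simp\<close>.\<close>
  have sum: "(\<Sum>k<16. f k) = ?sum f" for f
    by (simp only: lessThan_atLeast0 interv_sum_list_conv_sum_set_nat set_upt)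
  have check: "\<forall>i\<in>set [0..<16]. \<forall>j\<in>set [0..<16].
      ?sum (\<lambda>k. core_reflection ! i ! k * core_reflection ! k ! j) = (if i = j then 484 else 0) \<and>
      ?sum (\<lambda>k. of_bool (k \<in> core_neighbours i) * core_reflection ! k ! j) =
      ?sum (\<lambda>k. core_reflection ! i ! k * of_bool (k \<in> core_neighbours j))"
    by code_simp
  have "i \<in> set [0..<16]" "j \<in> set [0..<16]" using assms by simp_all
  note c = bspec[OF bspec[OF check this(1)] this(2)]
  show "(\<Sum>k<16. core_reflection ! i ! k * core_reflection ! k ! j) = (if i = j then 484 else 0)"
    unfolding sum by (rule conjunct1[OF c])
  show "(\<Sum>k<16. of_bool (k \<in> core_neighbours i) * core_reflection ! k ! j) =
      (\<Sum>k<16. core_reflection ! i ! k * of_bool (k \<in> core_neighbours j))"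
    unfolding sum by (rule conjunct2[OF c])
qed

text \<open>The sums say that the all-ones vector is fixed, row 0 and column 3 that the reflection
  swaps the attachment vertices.\<close>

lemma core_reflection_margins:
  assumes "i < 16"
  shows "(\<Sum>k<16. core_reflection ! i ! k) = 22" "(\<Sum>k<16. core_reflection ! k ! i) = 22"
    and "core_reflection ! 0 ! i = (if i = 3 then 22 else 0)"
    and "core_reflection ! i ! 3 = (if i = 0 then 22 else 0)"
  using assms by (elim less_16_cases; simp add: core_reflection_def eval_nat_numeral)+

definition leafy_core_reflection :: "nat \<Rightarrow> nat \<Rightarrow> rat" where
  "leafy_core_reflection i j =
    (if i < 16 \<and> j < 16 then of_int (core_reflection ! i ! j) / 22 else if i = j then 1 else 0)"

lemma sum_split_16:
  fixes f :: "nat \<Rightarrow> 'a::comm_monoid_add"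
  assumes "16 \<le> n"
  shows "(\<Sum>k<n. f k) = (\<Sum>k<16. f k) + (\<Sum>k\<in>{16..<n}. f k)"
proof -
  have "{..<n} = {..<16} \<union> {16..<n}" using assms by auto
  then show ?thesis by (simp add: sum.union_disjoint ivl_disj_int)
qed

lemma leafy_core_reflection_core [simp]:
  "i < 16 \<Longrightarrow> j < 16 \<Longrightarrow> leafy_core_reflection i j = of_int (core_reflection ! i ! j) / 22"
  by (simp add: leafy_core_reflection_def)

lemma leafy_core_reflection_leaf [simp]:
  "\<not> i < 16 \<or> \<not> j < 16 \<Longrightarrow> leafy_core_reflection i j = (if i = j then 1 else 0)"
  by (auto simp: leafy_core_reflection_def)

lemma leafy_core_reflection_involution:
  assumes n: "16 \<le> n" and ij: "i < n" "j < n"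
  shows "(\<Sum>k<n. leafy_core_reflection i k * leafy_core_reflection k j) = (if i = j then 1 else 0)"
proof (cases "i < 16 \<and> j < 16")
  case True
  have "(\<Sum>k<16. leafy_core_reflection i k * leafy_core_reflection k j) =
      of_int (\<Sum>k<16. core_reflection ! i ! k * core_reflection ! k ! j) / 484"
    unfolding of_int_sum sum_divide_distrib using True by (intro sum.cong) simp_all
  also have "\<dots> = (if i = j then 1 else 0)"
    using True by (simp add: core_reflection_products(1))
  finally show ?thesis
    using True by (simp add: sum_split_16[OF n] sum.neutral)
next
  case False
  have "(\<Sum>k<n. leafy_core_reflection i k * leafy_core_reflection k j) =
      (\<Sum>k<n. if k = (if i < 16 then j else i) then if i = j then 1 else 0 else 0)"
    using False by (intro sum.cong) auto
  then show ?thesis using ij by simp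
qed

lemma leafy_core_reflection_margins:
  assumes n: "16 \<le> n" and i: "i < n"
  shows "(\<Sum>k<n. leafy_core_reflection i k) = 1" "(\<Sum>k<n. leafy_core_reflection k i) = 1"
proof -
  have "(\<Sum>k<n. leafy_core_reflection i k) = 1 \<and> (\<Sum>k<n. leafy_core_reflection k i) = 1"
  proof (cases "i < 16")
    case True
    have "(\<Sum>k<16. leafy_core_reflection i k) = of_int (\<Sum>k<16. core_reflection ! i ! k) / 22"
      "(\<Sum>k<16. leafy_core_reflection k i) = of_int (\<Sum>k<16. core_reflection ! k ! i) / 22"
      unfolding of_int_sum sum_divide_distrib using True by (intro sum.cong; simp)+
    then show ?thesis
      using True by (simp add: sum_split_16[OF n] core_reflection_margins sum.neutral)
  next
    case False
    then show ?thesis using i by simp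
  qed
  then show "(\<Sum>k<n. leafy_core_reflection i k) = 1" "(\<Sum>k<n. leafy_core_reflection k i) = 1" by simp_all
qed

text \<open>Compare blocks. Core against core is commutation with the core adjacency matrix, the
  mixed blocks express the swap of 0 and 3, and leaf against leaf both sides vanish.\<close>

lemma leafy_core_reflection_intertwines:
  assumes n: "16 \<le> n" and ij: "i < n" "j < n"
  shows "(\<Sum>k<n. of_bool ((i, k) \<in> parcs (leafy_core n 0)) * leafy_core_reflection k j) =
    (\<Sum>k<n. leafy_core_reflection i k * of_bool ((k, j) \<in> parcs (leafy_core n 3)))"
proof -
  have arc: "(u, v) \<in> parcs (leafy_core n r) \<longleftrightarrow> u < n \<and> v < n \<and>
      (if u < 16 then if v < 16 then v \<in> core_neighbours u else u = r else v = r)" if "r < 16" for u v r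
    using that n by (rule in_parcs_leafy_core)
  have lhs: "(\<Sum>k<n. of_bool ((i, k) \<in> parcs (leafy_core n 0)) * leafy_core_reflection k j) =
      (\<Sum>k<16. of_bool (if i < 16 then k \<in> core_neighbours i else k = 0) * leafy_core_reflection k j)
      + (if j < 16 then 0 else of_bool (i = 0))"
  proof -
    have "(\<Sum>k<16. of_bool ((i, k) \<in> parcs (leafy_core n 0)) * leafy_core_reflection k j) =
        (\<Sum>k<16. of_bool (if i < 16 then k \<in> core_neighbours i else k = 0) * leafy_core_reflection k j)"
      using n ij by (intro sum.cong HOL.refl) (simp add: arc)
    moreover have "(\<Sum>k\<in>{16..<n}. of_bool ((i, k) \<in> parcs (leafy_core n 0)) * leafy_core_reflection k j) =
        (\<Sum>k\<in>{16..<n}. if k = j then of_bool (i = 0) else 0)"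
      using n ij by (intro sum.cong HOL.refl) (auto simp: arc)
    ultimately show ?thesis using ij by (simp add: sum_split_16[OF n])
  qed
  have rhs: "(\<Sum>k<n. leafy_core_reflection i k * of_bool ((k, j) \<in> parcs (leafy_core n 3))) =
      (\<Sum>k<16. leafy_core_reflection i k * of_bool (if j < 16 then k \<in> core_neighbours j else k = 3))
      + (if i < 16 then 0 else of_bool (j = 3))"
  proof -
    have "(\<Sum>k<16. leafy_core_reflection i k * of_bool ((k, j) \<in> parcs (leafy_core n 3))) =
        (\<Sum>k<16. leafy_core_reflection i k * of_bool (if j < 16 then k \<in> core_neighbours j else k = 3))"
      using n ij by (intro sum.cong HOL.refl) (simp add: arc core_neighbours_sym)
    moreover have "(\<Sum>k\<in>{16..<n}. leafy_core_reflection i k * of_bool ((k, j) \<in> parcs (leafy_core n 3))) =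
        (\<Sum>k\<in>{16..<n}. if k = i then of_bool (j = 3) else 0)"
      using n ij by (intro sum.cong HOL.refl) (auto simp: arc)
    ultimately show ?thesis using ij by (simp add: sum_split_16[OF n])
  qed
  consider "i < 16" "j < 16" | "i < 16" "\<not> j < 16" | "\<not> i < 16" "j < 16" | "\<not> i < 16" "\<not> j < 16"
    by blast
  then show ?thesis
  proof cases
    case 1
    have "(\<Sum>k<16. of_bool (k \<in> core_neighbours i) * leafy_core_reflection k j) =
        of_int (\<Sum>k<16. of_bool (k \<in> core_neighbours i) * core_reflection ! k ! j) / 22"
      unfolding of_int_sum sum_divide_distrib using 1 by (intro sum.cong) simp_all
    also have "\<dots> = of_int (\<Sum>k<16. core_reflection ! i ! k * of_bool (k \<in> core_neighbours j)) / 22"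
      using core_reflection_products(2)[OF 1] by simp
    also have "\<dots> = (\<Sum>k<16. leafy_core_reflection i k * of_bool (k \<in> core_neighbours j))"
      unfolding of_int_sum sum_divide_distrib using 1 by (intro sum.cong) simp_all
    finally show ?thesis using 1 unfolding lhs rhs by simp
  next
    case 2
    have core: "(\<Sum>k<16. of_bool (k \<in> core_neighbours i) * leafy_core_reflection k j) = 0"
      using 2 by (intro sum.neutral) auto
    have "(\<Sum>k<16. leafy_core_reflection i k * of_bool (k = 3)) =
        (\<Sum>k<16. if k = 3 then leafy_core_reflection i k else 0)"
      by (intro sum.cong) auto
    also have "\<dots> = of_bool (i = 0)"
      using 2 core_reflection_margins(4)[of i] by simp
    finally show ?thesis
      unfolding lhs rhs by (simp only: 2 core if_True if_False add_0_left add_0_right)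
  next
    case 3
    have core: "(\<Sum>k<16. leafy_core_reflection i k * of_bool (k \<in> core_neighbours j)) = 0"
      using 3 by (intro sum.neutral) auto
    have "(\<Sum>k<16. of_bool (k = 0) * leafy_core_reflection k j) =
        (\<Sum>k<16. if k = 0 then leafy_core_reflection k j else 0)"
      by (intro sum.cong) auto
    also have "\<dots> = of_bool (j = 3)"
      using 3 core_reflection_margins(3)[of j] by simp
    finally show ?thesis
      unfolding lhs rhs by (simp only: 3 core if_True if_False add_0_left add_0_right)
  next
    case 4
    have "(\<Sum>k<16. of_bool (k = 0) * leafy_core_reflection k j) = 0"
      "(\<Sum>k<16. leafy_core_reflection i k * of_bool (k = 3)) = 0"
      using 4 by (auto intro!: sum.neutral)
    then show ?thesis using 4 unfolding lhs rhs by simp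
  qed
qed

lemma leafy_core_cospectral:
  assumes "16 \<le> n"
  shows "cospectral (leafy_core n 0) (leafy_core n 3)"
    and "cospectral (graph_complement (leafy_core n 0)) (graph_complement (leafy_core n 3))"
proof -
  have loopfree: "(v, v) \<notin> parcs (leafy_core n r)" if "r < 16" for v r
  proof -
    interpret racg_graph "leafy_core n r"
      by (intro racg_graph.intro pair_graph_leafy_core) (use that assms in auto)
    show ?thesis by (rule irrefl)
  qed
  have loopfree_0: "(v, v) \<notin> parcs (leafy_core n 0)" and loopfree_3: "(v, v) \<notin> parcs (leafy_core n 3)" for v
    by (simp_all add: loopfree)
  note cospectral = cospectral_of_involution[OF pverts_leafy_core pverts_leafy_core loopfree_0 loopfree_3
      leafy_core_reflection_involution[OF assms] leafy_core_reflection_margins(1)[OF assms]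
      leafy_core_reflection_margins(2)[OF assms] leafy_core_reflection_intertwines[OF assms]]
  show "cospectral (leafy_core n 0) (leafy_core n 3)"
    by (rule cospectral(1))
  show "cospectral (graph_complement (leafy_core n 0)) (graph_complement (leafy_core n 3))"
    by (rule cospectral(2))
qed


theorem theorem1p1:
  fixes n :: nat
  assumes "n \<ge> 17"
  shows "\<exists>(I :: nat set) (T1 :: nat \<Rightarrow> nat pair_pre_digraph) (T2 :: nat \<Rightarrow> nat pair_pre_digraph).
    I \<noteq> {} \<and> I \<subseteq> {1..} \<and>
    (\<forall>i\<in>I.
      tree_graph (T1 i) \<and> card (pverts (T1 i)) = n \<and>
      tree_graph (T2 i) \<and> card (pverts (T2 i)) = n \<and>
      \<not> digraph_iso (with_proj (T1 i)) (with_proj (T2 i)) \<and>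
      cospectral (T1 i) (T2 i) \<and>
      cospectral (graph_complement (T1 i)) (graph_complement (T2 i)) \<and>
      racg_geodesic_growth_series (T1 i) = racg_geodesic_growth_series (T2 i))"
proof -
  have n: "16 \<le> n" "0 < n" using assms by simp_all
  have "\<not> digraph_iso (with_proj (leafy_core n 0)) (with_proj (leafy_core n 3))"
    using supports_at_distance_three_iso supports_at_distance_three_leafy_core_0[OF assms]
      not_supports_at_distance_three_leafy_core_3[OF n(1)] by blast
  \<comment> \<open>One pair of trees for each \<open>n\<close>, with the single index 1, is
    enough.\<close>
  then show ?thesis
    using n by (intro exI[of _ "{1}"] exI[of _ "\<lambda>_. leafy_core n 0"] exI[of _ "\<lambda>_. leafy_core n 3"])
      (simp add: tree_graph_leafy_core pverts_leafy_core leafy_core_cospectral leafy_core_geodesic_growth)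
qed

end
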